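(* Let $R=R(X_\ell,S)$ be a simply laced extended affine root system of type $X_\ell$ and nullity $\nu$, with Heisenberg-like group $\mathcal H$. (i) If $X_\ell=A_1$, then $$Z(\mathcal H)=\langle c_{r,s}^2,\ z_J\mid 1\le r<s\le\nu,\ J\in\mathrm{supp}(S)\rangle.$$ In particular, if $S$ is a lattice, then $Z(\mathcal H)=\langle c_{r,s}\mid 1\le r<s\le\nu\rangle$. (ii) If $X_\ell=A_\ell$ ($\ell\ge2$), $D_\ell$ or $E_\ell$, then $Z(\mathcal H)=\langle c_{r,s}\mid1\le r<s\le\nu\rangle$.
   Context: $Z(G)$ denotes the center of a group $G$. Extended affine root systems. Let $V$ be a nontrivial finite-dimensional real vector space with a positive semidefinite symmetric bilinear form $(\cdot,\cdot)$ with radical $V^0$; for nonisotropic $\alpha$ put $\alpha^\vee=2\alpha/(\alpha,\alpha)$, and for $A\subseteq V$ let $A^\times=\{\alpha\in A:(\alpha,\alpha)\neq0\}$. A subset $R\subseteq V$ is an extended affine root system if: $0\in R$; $-R=R$; $R$ spans $V$; $\alpha\in R^\times\Rightarrow 2\alpha\notin R$; $R$ is discrete; for $\alpha\in R^\times,\beta\in R$ there are integers $d,u\ge0$ such that, for $n\in\mathbb Z$, $\beta+n\alpha\in R\iff -d\le n\le u$, and $(\beta,\alpha^\vee)=d-u$; $R$ is not a union of two nonempty mutually orthogonal subsets; for each isotropic $\sigma\in R$ there is $\alpha\in R^\times$ with $\alpha+\sigma\in R$. Nullity: $\nu=\dim V^0$; rank: $\ell=\dim V/V^0$; the type is that of the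 image of $R$ in $V/V^0$, an irreducible finite root system (with $0$ included). $R$ is simply laced if its type $X_\ell$ is $A_\ell$, $D_\ell$, $E_6$, $E_7$ or $E_8$. A semilattice in $V^0$ is a discrete spanning subset $S$ with $0\in S$ and $S\pm2S\subseteq S$; it is a lattice if $S\pm S\subseteq S$. By known structure theory, for $R$ simply laced one can fix a complement $\dot V$ of $V^0$ in $V$ such that $\dot R=\{\dot\alpha\in\dot V:\dot\alpha+\sigma\in R\text{ for some }\sigma\in V^0\}$ is a finite root system of type $X_\ell$ (with $0$) in $\dot V$ and $R=R(X_\ell,S)=(S+S)\cup(\dot R+S)$ with $S$ a semilattice in $V^0$; if $\ell>1$, $S$ is a lattice. Fix a fundamental system $\alpha_1,\dots,\alpha_\ell$ of $\dot R$, with $(\alpha_i,\alpha_i)=2$, and a $\mathbb Z$-basis $B=\{\sigma_1,\dots,\sigma_\nu\}\subseteq S$ of the lattice $\Lambda$ generated by $S$. Supporting class: for $\sigma\in\Lambda$ let $\mathrm{supp}(\sigma)\subseteq\{1,\dots,\nu\}$ be the set of $r$ for which the coefficient of $\sigma_r$ in $\sigma$ is odd, and $\mathrm{supp}(S)=\{\mathrm{supp}(\sigma):\sigma\in S\}$; then $S=\biguplus_{J\in\mathrm{supp}(S)}(\sum_{r\in J}\sigma_r+2\Lambda)$. Groups: $\tilde V=V\oplus(V^0)^*$, with the form extended from $V$ by $(\dot V,(V^0)^* )=((V^0)^*,(V^0)^* )=0$ and $(\sigma_r,\lambda_s)=\delta_{r,s}$, where $\lambda_1,\dots,\lambda_\nu$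 is a basis of $(V^0)^*$. For $\alpha\in V^\times$, $w_\alpha(u)=u-(u,\alpha^\vee)\alpha$ ($u\in\tilde V$). The Heisenberg-like group is $\mathcal H=\langle w_{\alpha+\sigma}w_\alpha:\alpha\in R^\times,\sigma\in V^0,\alpha+\sigma\in R\rangle\le GL(\tilde V)$. For $\alpha\in V,\sigma\in V^0$ put $T_\alpha^\sigma(u)=u-(\sigma,u)\alpha+(\alpha,u)\sigma-\frac{(\alpha,\alpha)}2(\sigma,u)\sigma$ and $c_{r,s}=T_{\sigma_r}^{\sigma_s}$; the $c_{r,s}$ commute. For $J\in\mathrm{supp}(S)$, $z_J=\prod_{r,s\in J,\,r<s}c_{r,s}$ (empty product $=1$).
   Formalization: Nullity ν = 1 is excluded: there the right-hand sides are trivial, while H is abelian and nontrivial, so the claim fails. The condition that R is not a union of two nonempty mutually orthogonal subsets is imposed on R^×, since for R itself {0} and R always violate it. *)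

theory Defs
  imports "HOL-Analysis.Analysis" "HOL-Algebra.Bij" "HOL-Algebra.Generated_Groups"
begin

section \<open>Extended affine root systems\<close>

text \<open>
  The ambient space \<open>V\<close> is the whole of a type of class \<open>euclidean_space\<close>. That class only supplies
  finite dimension, nontriviality and the topology; its inner product plays no role, the form
  being the separate parameter \<open>B\<close>.
\<close>

definition psd_form :: "('v::real_vector \<Rightarrow> 'v \<Rightarrow> real) \<Rightarrow> bool" where
  "psd_form B \<longleftrightarrow> bilinear B \<and> (\<forall>x y. B x y = B y x) \<and> (\<forall>x. 0 \<le> B x x)"

definition form_radical :: "('v::real_vector \<Rightarrow> 'v \<Rightarrow> real) \<Rightarrow> 'v set" where
  "form_radical B = {x. \<forall>y. B x y = 0}"

definition nonisotropic :: "('v::real_vector \<Rightarrow> 'v \<Rightarrow> real) \<Rightarrow> 'v set \<Rightarrow> 'v set" where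
  "nonisotropic B A = {\<alpha> \<in> A. B \<alpha> \<alpha> \<noteq> 0}"

definition coroot :: "('v::real_vector \<Rightarrow> 'v \<Rightarrow> real) \<Rightarrow> 'v \<Rightarrow> 'v" where
  "coroot B \<alpha> = (2 / B \<alpha> \<alpha>) *\<^sub>R \<alpha>"

text \<open>
  Indecomposability is required of the set of nonisotropic roots. For \<open>R\<close> itself it would be
  unsatisfiable: \<open>0\<close> is orthogonal to everything, so \<open>R\<close> is always the union of the mutually
  orthogonal nonempty sets \<open>{0}\<close> and \<open>R\<close>.
\<close>

definition ears :: "('v::euclidean_space \<Rightarrow> 'v \<Rightarrow> real) \<Rightarrow> 'v set \<Rightarrow> bool" where
  "ears B R \<longleftrightarrow>
     psd_form B \<and>
     0 \<in> R \<and>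
     uminus ` R = R \<and>
     span R = UNIV \<and>
     (\<forall>\<alpha> \<in> nonisotropic B R. 2 *\<^sub>R \<alpha> \<notin> R) \<and>
     discrete R \<and>
     (\<forall>\<alpha> \<in> nonisotropic B R. \<forall>\<beta> \<in> R. \<exists>d u :: nat.
        (\<forall>n::int. \<beta> + of_int n *\<^sub>R \<alpha> \<in> R \<longleftrightarrow> - int d \<le> n \<and> n \<le> int u) \<and>
        B \<beta> (coroot B \<alpha>) = real d - real u) \<and>
     \<not> (\<exists>R1 R2. R1 \<noteq> {} \<and> R2 \<noteq> {} \<and> nonisotropic B R = R1 \<union> R2 \<and>
          (\<forall>\<alpha> \<in> R1. \<forall>\<beta> \<in> R2. B \<alpha> \<beta> = 0)) \<and>
     (\<forall>\<sigma> \<in> R. B \<sigma> \<sigma> = 0 \<longrightarrow> (\<exists>\<alpha> \<in> nonisotropic B R. \<alpha> + \<sigma> \<in> R))"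


section \<open>Finite root systems of simply laced type\<close>

text \<open>Finite root systems contain \<open>0\<close> and are reduced (so that \<open>BC\<close> does not occur).\<close>

definition finite_root_system ::
  "('v::real_vector \<Rightarrow> 'v \<Rightarrow> real) \<Rightarrow> 'v set \<Rightarrow> 'v set \<Rightarrow> bool" where
  "finite_root_system B W D \<longleftrightarrow>
     (\<forall>x \<in> W. x \<noteq> 0 \<longrightarrow> 0 < B x x) \<and>
     finite D \<and> 0 \<in> D \<and> span D = W \<and>
     (\<forall>\<alpha> \<in> D - {0}. 2 *\<^sub>R \<alpha> \<notin> D \<and>
        (\<forall>\<beta> \<in> D. B \<beta> (coroot B \<alpha>) \<in> \<int> \<and> \<beta> - B \<beta> (coroot B \<alpha>) *\<^sub>R \<alpha> \<in> D))"

definition fundamental_system :: "'v::real_vector set \<Rightarrow> nat \<Rightarrow> (nat \<Rightarrow> 'v) \<Rightarrow> bool" where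
  "fundamental_system D l a \<longleftrightarrow>
     inj_on a {1..l} \<and> independent (a ` {1..l}) \<and> a ` {1..l} \<subseteq> D \<and>
     (\<forall>\<beta> \<in> D. \<exists>k :: nat \<Rightarrow> nat. \<beta> = (\<Sum>i\<in>{1..l}. real (k i) *\<^sub>R a i) \<or>
                                 \<beta> = - (\<Sum>i\<in>{1..l}. real (k i) *\<^sub>R a i))"

datatype simply_laced_type = A_type nat | D_type nat | E_type nat

fun type_rank :: "simply_laced_type \<Rightarrow> nat" where
  "type_rank (A_type l) = l"
| "type_rank (D_type l) = l"
| "type_rank (E_type l) = l"

fun valid_type :: "simply_laced_type \<Rightarrow> bool" where
  "valid_type (A_type l) \<longleftrightarrow> 1 \<le> l"
| "valid_type (D_type l) \<longleftrightarrow> 4 \<le> l"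
| "valid_type (E_type l) \<longleftrightarrow> l \<in> {6, 7, 8}"

text \<open>
  Edges \<open>{i, j}\<close>, \<open>i < j\<close>, of the Dynkin diagram on \<open>{1..l}\<close>, in the labelling of Bourbaki: in
  type \<open>D\<close> the node \<open>l\<close> is attached to \<open>l - 2\<close>; in type \<open>E\<close> the chain is \<open>1, 3, 4, ..., l\<close> and the
  node \<open>2\<close> is attached to \<open>4\<close>.
\<close>

fun dynkin_edge :: "simply_laced_type \<Rightarrow> nat \<Rightarrow> nat \<Rightarrow> bool" where
  "dynkin_edge (A_type l) i j \<longleftrightarrow> j = i + 1"
| "dynkin_edge (D_type l) i j \<longleftrightarrow> (j = i + 1 \<and> j < l) \<or> (j = l \<and> i + 2 = l)"
| "dynkin_edge (E_type l) i j \<longleftrightarrow> (i, j) = (1, 3) \<or> (i, j) = (2, 4) \<or> (3 \<le> i \<and> j = i + 1)"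

definition cartan_matrix :: "simply_laced_type \<Rightarrow> nat \<Rightarrow> nat \<Rightarrow> int" where
  "cartan_matrix X i j =
     (if i = j then 2 else if dynkin_edge X i j \<or> dynkin_edge X j i then - 1 else 0)"

definition has_type ::
  "('v::real_vector \<Rightarrow> 'v \<Rightarrow> real) \<Rightarrow> 'v set \<Rightarrow> simply_laced_type \<Rightarrow> bool" where
  "has_type B D X \<longleftrightarrow> valid_type X \<and>
     (\<exists>b. fundamental_system D (type_rank X) b \<and>
          (\<forall>i \<in> {1..type_rank X}. \<forall>j \<in> {1..type_rank X}.
             B (b i) (coroot B (b j)) = of_int (cartan_matrix X i j)))"


section \<open>Semilattices and the description of \<open>R\<close>\<close>

definition semilattice_in :: "'v::euclidean_space set \<Rightarrow> 'v set \<Rightarrow> bool" where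
  "semilattice_in W S \<longleftrightarrow>
     S \<subseteq> W \<and> discrete S \<and> span S = W \<and> 0 \<in> S \<and>
     (\<forall>\<sigma> \<in> S. \<forall>\<tau> \<in> S. \<sigma> + 2 *\<^sub>R \<tau> \<in> S \<and> \<sigma> - 2 *\<^sub>R \<tau> \<in> S)"

definition lattice_in :: "'v::euclidean_space set \<Rightarrow> 'v set \<Rightarrow> bool" where
  "lattice_in W S \<longleftrightarrow>
     semilattice_in W S \<and> (\<forall>\<sigma> \<in> S. \<forall>\<tau> \<in> S. \<sigma> + \<tau> \<in> S \<and> \<sigma> - \<tau> \<in> S)"

definition complement_of :: "'v::real_vector set \<Rightarrow> 'v set \<Rightarrow> bool" where
  "complement_of W U \<longleftrightarrow> subspace U \<and> U \<inter> W = {0} \<and> U + W = UNIV"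

definition finite_part ::
  "('v::real_vector \<Rightarrow> 'v \<Rightarrow> real) \<Rightarrow> 'v set \<Rightarrow> 'v set \<Rightarrow> 'v set" where
  "finite_part B U R = {\<alpha> \<in> U. \<exists>\<sigma> \<in> form_radical B. \<alpha> + \<sigma> \<in> R}"

text \<open>
  \<open>R\<close> is the extended affine root system \<open>R(X, S)\<close> relative to the complement \<open>U\<close> of the
  radical. The type of \<open>R\<close> is the type of its image in \<open>V\<close> modulo the radical; the isometry from \<open>U\<close>
  onto this quotient carries \<open>finite_part B U R\<close> onto that image, hence the type is read off there.
\<close>

definition simply_laced_ears ::
  "('v::euclidean_space \<Rightarrow> 'v \<Rightarrow> real) \<Rightarrow> 'v set \<Rightarrow> simply_laced_type \<Rightarrow> 'v set \<Rightarrow> 'v set \<Rightarrow> bool" where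
  "simply_laced_ears B R X U S \<longleftrightarrow>
     ears B R \<and>
     complement_of (form_radical B) U \<and>
     finite_root_system B U (finite_part B U R) \<and>
     has_type B (finite_part B U R) X \<and>
     semilattice_in (form_radical B) S \<and>
     (1 < type_rank X \<longrightarrow> lattice_in (form_radical B) S) \<and>
     R = (S + S) \<union> (finite_part B U R + S)"


section \<open>The lattice generated by \<open>S\<close> and supporting classes\<close>

definition int_scale :: "int \<Rightarrow> 'v::real_vector \<Rightarrow> 'v" where
  "int_scale n x = of_int n *\<^sub>R x"

interpretation int_module: module "int_scale :: int \<Rightarrow> 'v::real_vector \<Rightarrow> 'v"
  by standard (simp_all add: int_scale_def algebra_simps)

text \<open>A basis over the integers of the subgroup generated by \<open>S\<close>, consisting of elements of \<open>S\<close>.\<close>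

definition int_basis :: "'v::real_vector set \<Rightarrow> nat \<Rightarrow> (nat \<Rightarrow> 'v) \<Rightarrow> bool" where
  "int_basis S \<nu> s \<longleftrightarrow>
     s ` {1..\<nu>} \<subseteq> S \<and> inj_on s {1..\<nu>} \<and> int_module.independent (s ` {1..\<nu>}) \<and>
     int_module.span (s ` {1..\<nu>}) = int_module.span S"

definition supp_class :: "nat \<Rightarrow> (nat \<Rightarrow> 'v::real_vector) \<Rightarrow> 'v \<Rightarrow> nat set" where
  "supp_class \<nu> s x = {r \<in> {1..\<nu>}. odd (int_module.representation (s ` {1..\<nu>}) x (s r))}"


section \<open>The Heisenberg-like group\<close>

text \<open>
  The dual of the radical is realised as the space of linear functionals on \<open>V\<close> that vanish on the
  complement \<open>U\<close>; restriction to the radical identifies the two. The extended form pairs a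
  functional with a vector by evaluation, so that the functionals dual to a basis \<open>s\<close> of the radical
  are the \<open>\<lambda>\<^sub>1, ..., \<lambda>\<^sub>\<nu>\<close> with \<open>(s r, \<lambda>\<^sub>t) = \<delta>\<^sub>r\<^sub>t\<close>, and the functionals are orthogonal to \<open>U\<close> and to one
  another.
\<close>

type_synonym 'v hyp = "'v \<times> ('v \<Rightarrow>\<^sub>L real)"

definition hyp_space :: "'v::euclidean_space set \<Rightarrow> 'v hyp set" where
  "hyp_space U = {(v, f). \<forall>x \<in> U. blinfun_apply f x = 0}"

definition hyp_form ::
  "('v::euclidean_space \<Rightarrow> 'v \<Rightarrow> real) \<Rightarrow> 'v hyp \<Rightarrow> 'v hyp \<Rightarrow> real" where
  "hyp_form B x y =
     B (fst x) (fst y) + blinfun_apply (snd x) (fst y) + blinfun_apply (snd y) (fst x)"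

definition emb :: "'v::euclidean_space \<Rightarrow> 'v hyp" where
  "emb v = (v, 0)"

text \<open>As in \<^const>\<open>BijGroup\<close>, group elements are functions that are \<^const>\<open>undefined\<close> off the space.\<close>

definition GL :: "'u::real_vector set \<Rightarrow> ('u \<Rightarrow> 'u) monoid" where
  "GL W = (BijGroup W)\<lparr>carrier :=
     {g \<in> Bij W. \<forall>x \<in> W. \<forall>y \<in> W. \<forall>a b. g (a *\<^sub>R x + b *\<^sub>R y) = a *\<^sub>R g x + b *\<^sub>R g y}\<rparr>"

abbreviation hyp_GL :: "'v::euclidean_space set \<Rightarrow> ('v hyp \<Rightarrow> 'v hyp) monoid" where
  "hyp_GL U \<equiv> GL (hyp_space U)"

definition refl_map ::
  "('v::euclidean_space \<Rightarrow> 'v \<Rightarrow> real) \<Rightarrow> 'v set \<Rightarrow> 'v \<Rightarrow> 'v hyp \<Rightarrow> 'v hyp" where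
  "refl_map B U \<alpha> =
     (\<lambda>u \<in> hyp_space U. u - hyp_form B u (emb (coroot B \<alpha>)) *\<^sub>R emb \<alpha>)"

text \<open>
  For nullity \<open>1\<close> this group is a nontrivial abelian group, whereas every \<open>c_elt\<close> below with indices in
  \<open>{1..\<nu>}\<close> is then the identity: its centre is generated by the \<open>c_elt\<close>'s only when the nullity is not \<open>1\<close>.
\<close>

definition heisenberg_group ::
  "('v::euclidean_space \<Rightarrow> 'v \<Rightarrow> real) \<Rightarrow> 'v set \<Rightarrow> 'v set \<Rightarrow> ('v hyp \<Rightarrow> 'v hyp) monoid" where
  "heisenberg_group B U R = (hyp_GL U)\<lparr>carrier := generate (hyp_GL U)
     {refl_map B U (\<alpha> + \<sigma>) \<otimes>\<^bsub>hyp_GL U\<^esub> refl_map B U \<alpha> | \<alpha> \<sigma>.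
        \<alpha> \<in> nonisotropic B R \<and> \<sigma> \<in> form_radical B \<and> \<alpha> + \<sigma> \<in> R}\<rparr>"

definition group_center :: "('g, 'm) monoid_scheme \<Rightarrow> 'g set" where
  "group_center G = {z \<in> carrier G. \<forall>g \<in> carrier G. z \<otimes>\<^bsub>G\<^esub> g = g \<otimes>\<^bsub>G\<^esub> z}"

definition T_map ::
  "('v::euclidean_space \<Rightarrow> 'v \<Rightarrow> real) \<Rightarrow> 'v set \<Rightarrow> 'v \<Rightarrow> 'v \<Rightarrow> 'v hyp \<Rightarrow> 'v hyp" where
  "T_map B U \<alpha> \<sigma> = (\<lambda>u \<in> hyp_space U.
     u - hyp_form B (emb \<sigma>) u *\<^sub>R emb \<alpha> + hyp_form B (emb \<alpha>) u *\<^sub>R emb \<sigma>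
       - (B \<alpha> \<alpha> / 2 * hyp_form B (emb \<sigma>) u) *\<^sub>R emb \<sigma>)"

definition c_elt ::
  "('v::euclidean_space \<Rightarrow> 'v \<Rightarrow> real) \<Rightarrow> 'v set \<Rightarrow> (nat \<Rightarrow> 'v) \<Rightarrow> nat \<Rightarrow> nat \<Rightarrow> 'v hyp \<Rightarrow> 'v hyp" where
  "c_elt B U s r t = T_map B U (s r) (s t)"

text \<open>
  The \<open>c\<close>'s commute, so the product may be taken in lexicographic order.
\<close>

definition z_elt ::
  "('v::euclidean_space \<Rightarrow> 'v \<Rightarrow> real) \<Rightarrow> 'v set \<Rightarrow> (nat \<Rightarrow> 'v) \<Rightarrow> nat set \<Rightarrow> 'v hyp \<Rightarrow> 'v hyp" where
  "z_elt B U s J = foldr (mult (hyp_GL U))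
     [c_elt B U s r t. r \<leftarrow> sorted_list_of_set J, t \<leftarrow> sorted_list_of_set J, r < t]
     \<one>\<^bsub>hyp_GL U\<^esub>"

end

theory Submission
  imports Defs
begin

text \<open>
  Write an element of the hyperbolic space as \<open>(v, f)\<close>, and let \<open>V0\<close> be the radical. A generator
  \<open>w\<^bsub>\<beta>+\<rho>\<^esub> w\<^bsub>\<beta>+\<tau>\<^esub>\<close>, with \<open>\<beta>\<close> a finite root and \<open>\<rho>\<close>, \<open>\<tau>\<close> in \<open>S\<close>, equals \<open>T\<^sub>\<beta>\<^sup>\<rho>\<close> times \<open>T\<^sub>\<beta>\<close> with exponent \<open>- \<tau>\<close>, so the
  Heisenberg-like group \<open>H\<close> is generated by the \<open>T\<^sub>\<beta>\<^sup>\<sigma>\<close> (\<open>heisenberg_carrier\<close>); here it matters that all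
  finite roots have norm 2 (\<open>root_norm\<close>). Every element of \<open>H\<close> is unipotent: it adds to \<open>v\<close> a radical
  vector linear in \<open>v\<close>, which amounts to a tensor \<open>\<Sum> a\<^sub>i \<otimes> x\<^sub>i\<close> with \<open>x\<^sub>i\<close> in \<open>V0\<close>, and a vector linear
  in \<open>f\<close>, which is determined by the same tensor up to a summand \<open>E f\<close> in the radical. In the coordinates
  \<open>(x, E)\<close> the tensors add, and the \<open>E\<close> add with an extra cocycle \<open>\<Sum> h\<^sub>i\<^sub>j (x\<^sub>j \<and> y\<^sub>i)\<close>, where \<open>h\<close> is integral and
  \<open>h\<^sub>i\<^sub>j + h\<^sub>j\<^sub>i = (a\<^sub>i, a\<^sub>j)\<close> (\<open>heis_mult\<close>). The \<open>c\<^sub>r\<^sub>,\<^sub>t\<close> are the elements \<open>(0, \<sigma>\<^sub>r \<and> \<sigma>\<^sub>t)\<close>.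

  An element with \<open>x = 0\<close> commutes with everything. Conversely, comparing the two cocycles, a central
  element satisfies \<open>w \<and> \<sigma> = 0\<close> for all \<open>\<sigma>\<close> in \<open>S\<close>, for each contraction \<open>w = \<Sum>\<^sub>j (a\<^sub>k, a\<^sub>j) x\<^sub>j\<close>. As the
  nullity is not 1 this forces \<open>w = 0\<close>, and then \<open>x = 0\<close> since the form is definite on \<open>U\<close>
  (\<open>center_coords_zero\<close>). So the center is the set of those \<open>(0, E)\<close> that lie in \<open>H\<close>, and it remains to find
  the group of these \<open>E\<close>. Upper bounds come from exhibiting a set of pairs \<open>(x, E)\<close> that contains the
  generators \<open>(k \<sigma>, 0)\<close> and is closed under the product law.

  In rank at least 2 the pairs with \<open>x\<^sub>i\<close> in the lattice and \<open>E\<close> in the integral span of the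
  \<open>\<sigma>\<^sub>r \<and> \<sigma>\<^sub>t\<close> form such a set. All these \<open>E\<close> occur, because two roots with product \<open>-1\<close> give
  commutators \<open>\<sigma>\<^sub>r \<and> \<sigma>\<^sub>t\<close>.

  In type \<open>A\<^sub>1\<close> commutators only give \<open>2 (\<sigma>\<^sub>r \<and> \<sigma>\<^sub>t)\<close>. If \<open>\<sigma>\<^sub>J = \<Sum>\<^sub>J \<sigma>\<^sub>r\<close> is in \<open>S\<close>, the ordered product of the
  \<open>(\<sigma>\<^sub>r, 0)\<close> over \<open>J\<close> differs from \<open>(\<sigma>\<^sub>J, 0)\<close> by \<open>z\<^sub>J\<close>, so \<open>z\<^sub>J\<close> is in \<open>H\<close> too. Modulo 2 the cocycle is the
  polarization of the quadratic map \<open>q(n) = \<Sum>\<^bsub>r<t\<^esub> n\<^sub>r n\<^sub>t (\<sigma>\<^sub>r \<and> \<sigma>\<^sub>t)\<close>, so the condition that \<open>E - q(n)\<close> lies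
  in the group generated by these elements is closed under products. It holds for the generators \<open>(\<plusminus>\<sigma>, 0)\<close>,
  because \<open>q(n)\<close> agrees with \<open>z\<^sub>J\<close> modulo 2 when \<open>J\<close> is the support of \<open>\<sigma>\<close>.
\<close>

section \<open>Integral spans\<close>

lemma int_scale_closed:
  fixes P :: "'a::real_vector set"
  assumes "0 \<in> P" "\<And>x y. x \<in> P \<Longrightarrow> y \<in> P \<Longrightarrow> x - y \<in> P" "x \<in> P"
  shows "of_int n *\<^sub>R x \<in> P"
proof -
  have neg: "- y \<in> P" if "y \<in> P" for y
    using assms(2)[OF assms(1) that] by simp
  have add: "y + z \<in> P" if "y \<in> P" "z \<in> P" for y z
    using assms(2)[OF that(1) neg[OF that(2)]] by simp
  have nat: "of_nat m *\<^sub>R x \<in> P" for m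
    by (induction m) (auto simp: assms(1) scaleR_left_distrib intro: add assms(3))
  show ?thesis
    using nat neg[OF nat] by (cases n rule: int_cases2) auto
qed

lemma int_span_subset:
  fixes P :: "'a::real_vector set"
  assumes "A \<subseteq> P" "0 \<in> P" "\<And>x y. x \<in> P \<Longrightarrow> y \<in> P \<Longrightarrow> x - y \<in> P"
  shows "int_module.span A \<subseteq> P"
proof (rule int_module.span_minimal[OF assms(1)])
  have "x + y \<in> P" if "x \<in> P" "y \<in> P" for x y
    using assms(3)[OF that(1) assms(3)[OF assms(2) that(2)]] by simp
  then show "int_module.subspace P"
    unfolding int_module.subspace_def
    by (auto simp: int_scale_def assms(2) intro: int_scale_closed assms)
qed

lemma int_span_of_int_scale:
  "x \<in> int_module.span A \<Longrightarrow> of_int n *\<^sub>R x \<in> int_module.span A"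
  using int_module.span_scale[of x A n] by (simp add: int_scale_def)

section \<open>Unipotent maps of the hyperbolic extension\<close>

lemma GL_carrier_iff:
  "g \<in> carrier (GL W) \<longleftrightarrow> g \<in> Bij W \<and>
     (\<forall>x\<in>W. \<forall>y\<in>W. \<forall>a b. g (a *\<^sub>R x + b *\<^sub>R y) = a *\<^sub>R g x + b *\<^sub>R g y)"
  by (simp add: GL_def)

lemma GL_mult: "g \<in> carrier (GL W) \<Longrightarrow> h \<in> carrier (GL W) \<Longrightarrow> g \<otimes>\<^bsub>GL W\<^esub> h = compose W g h"
  by (simp add: GL_def BijGroup_def)

lemma GL_one: "\<one>\<^bsub>GL W\<^esub> = (\<lambda>x\<in>W. x)"
  by (simp add: GL_def BijGroup_def)

lemma group_GL:
  assumes W: "subspace W"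
  shows "group (GL W)"
proof -
  have lin: "a *\<^sub>R x + b *\<^sub>R y \<in> W" if "x \<in> W" "y \<in> W" for a b x y
    using W that by (simp add: subspace_add subspace_scale)
  have mem: "g x \<in> W" if "g \<in> carrier (GL W)" "x \<in> W" for g x
    using that by (auto simp: GL_carrier_iff dest: Bij_imp_funcset)
  have "subgroup (carrier (GL W)) (BijGroup W)"
  proof (rule group.subgroupI[OF group_BijGroup])
    show "carrier (GL W) \<subseteq> carrier (BijGroup W)"
      by (auto simp: GL_carrier_iff BijGroup_def)
    show "carrier (GL W) \<noteq> {}"
    proof -
      have "(\<lambda>x\<in>W. x) \<in> carrier (GL W)" using lin by (simp add: GL_carrier_iff id_Bij)
      then show ?thesis by blast
    qed
  next
    fix g assume g: "g \<in> carrier (GL W)"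
    then have gB: "g \<in> Bij W" by (simp add: GL_carrier_iff)
    then have inv: "inv\<^bsub>BijGroup W\<^esub> g = (\<lambda>x\<in>W. inv_into W g x)" 
      by (rule inv_BijGroup)
    have bij: "bij_betw g W W" using gB by (simp add: Bij_def)
    have "inv_into W g (a *\<^sub>R x + b *\<^sub>R y) = a *\<^sub>R inv_into W g x + b *\<^sub>R inv_into W g y"
      if x: "x \<in> W" and y: "y \<in> W" for a b x y
    proof -
      let ?x = "inv_into W g x" and ?y = "inv_into W g y"
      have xy: "?x \<in> W" "?y \<in> W" "g ?x = x" "g ?y = y"
        using bij x y gB by (auto simp: bij_betw_inv_into_right intro: Bij_inv_into_mem)
      then have "a *\<^sub>R x + b *\<^sub>R y = g (a *\<^sub>R ?x + b *\<^sub>R ?y)"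
        using g by (simp add: GL_carrier_iff)
      then show ?thesis
        using bij lin[OF xy(1,2)] by (simp add: bij_betw_inv_into_left)
    qed
    then show "inv\<^bsub>BijGroup W\<^esub> g \<in> carrier (GL W)"
      unfolding inv GL_carrier_iff using restrict_inv_into_Bij[OF gB] lin by auto
  next
    fix g h assume g: "g \<in> carrier (GL W)" and h: "h \<in> carrier (GL W)"
    have eq: "g \<otimes>\<^bsub>BijGroup W\<^esub> h = compose W g h"
      using g h by (simp add: BijGroup_def GL_carrier_iff)
    show "g \<otimes>\<^bsub>BijGroup W\<^esub> h \<in> carrier (GL W)"
      unfolding eq GL_carrier_iff using g h mem lin
      by (auto simp: GL_carrier_iff compose_Bij compose_eq)
  qed
  then have "group (BijGroup W\<lparr>carrier := carrier (GL W)\<rparr>)"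
    by (rule subgroup.subgroup_is_group[OF _ group_BijGroup])
  then show ?thesis by (simp add: GL_def)
qed

lemma subspace_hyp_space: "subspace (hyp_space U)"
  by (auto simp: subspace_def hyp_space_def zero_prod_def blinfun.bilinear_simps)

lemma group_hyp_GL: "group (hyp_GL U)"
  by (intro group_GL subspace_hyp_space)

text \<open>
  The common shape of the \<open>T_map\<close>, and hence of all elements of the Heisenberg-like group. \<open>P\<close> will
  take values in the radical and vanish on it.
\<close>

definition unip ::
  "'v::euclidean_space set \<Rightarrow> ('v \<Rightarrow> 'v) \<Rightarrow> (('v \<Rightarrow>\<^sub>L real) \<Rightarrow> 'v) \<Rightarrow> 'v hyp \<Rightarrow> 'v hyp" where
  "unip U P Q = (\<lambda>u \<in> hyp_space U. (fst u + P (fst u) + Q (snd u), snd u))"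

text \<open>
  The second components of the hyperbolic space are the functionals that vanish on \<open>U\<close>, so \<open>Q\<close> only matters there.
\<close>

lemma unip_cong:
  assumes "\<And>v. P v = P' v" "\<And>f. (\<forall>u\<in>U. blinfun_apply f u = 0) \<Longrightarrow> Q f = Q' f"
  shows "unip U P Q = unip U P' Q'"
  using assms by (auto simp: unip_def hyp_space_def intro!: restrict_ext)

lemma unip_in_GL:
  assumes P: "linear P" and Q: "linear Q" and PP: "\<And>v. P (P v) = 0"
  shows "unip U P Q \<in> carrier (hyp_GL U)"
proof -
  have lin: "a *\<^sub>R x + b *\<^sub>R y \<in> hyp_space U" if "x \<in> hyp_space U" "y \<in> hyp_space U" for a b x y
    using subspace_hyp_space[of U] that by (simp add: subspace_add subspace_scale)
  have PQ: "P (x + y) = P x + P y" "P (x - y) = P x - P y" "P (r *\<^sub>R x) = r *\<^sub>R P x"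
    "Q (f + g) = Q f + Q g" "Q (r *\<^sub>R f) = r *\<^sub>R Q f" for x y r f g
    using P Q by (simp_all add: linear_add linear_diff linear_scale)
  have "inj_on (unip U P Q) (hyp_space U)"
  proof (rule inj_onI)
    fix u w assume u: "u \<in> hyp_space U" and w: "w \<in> hyp_space U" and eq: "unip U P Q u = unip U P Q w"
    then have s: "snd u = snd w" and "fst u + P (fst u) = fst w + P (fst w)"
      by (auto simp: unip_def)
    then have d: "fst u - fst w = - P (fst u - fst w)" by (simp add: PQ algebra_simps)
    then have "P (fst u - fst w) = - P (P (fst u - fst w))"
      by (metis P linear_neg)
    then have "fst u = fst w" using d PP by simp
    with s show "u = w" by (simp add: prod_eq_iff)
  qed
  moreover have "unip U P Q ` hyp_space U = hyp_space U"
  proof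
    show "unip U P Q ` hyp_space U \<subseteq> hyp_space U" by (auto simp: unip_def hyp_space_def)
    show "hyp_space U \<subseteq> unip U P Q ` hyp_space U"
    proof
      fix u assume u: "u \<in> hyp_space U"
      \<comment> \<open>Solve \<open>w + P w = y\<close> for \<open>y = fst u - Q (snd u)\<close>: since \<open>P\<close> squares to zero, \<open>w = y - P y\<close>.\<close>
      define w where "w = fst u - Q (snd u) - P (fst u - Q (snd u))"
      have "(w, snd u) \<in> hyp_space U" using u by (auto simp: hyp_space_def)
      moreover have "u = unip U P Q (w, snd u)"
        using calculation by (simp add: unip_def w_def prod_eq_iff PQ PP)
      ultimately show "u \<in> unip U P Q ` hyp_space U" by blast
    qed
  qed
  ultimately have "unip U P Q \<in> Bij (hyp_space U)"
    by (simp add: Bij_def bij_betw_def unip_def)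
  then show ?thesis
    unfolding GL_carrier_iff using lin by (auto simp: unip_def PQ algebra_simps)
qed

lemma unip_mult:
  assumes "unip U P Q \<in> carrier (hyp_GL U)" "unip U P' Q' \<in> carrier (hyp_GL U)" "linear P"
  shows "unip U P Q \<otimes>\<^bsub>hyp_GL U\<^esub> unip U P' Q' =
    unip U (\<lambda>v. P v + P' v + P (P' v)) (\<lambda>f. Q f + Q' f + P (Q' f))"
proof -
  have "linear P \<Longrightarrow> P (x + y) = P x + P y" for x y by (rule linear_add)
  then show ?thesis
    unfolding GL_mult[OF assms(1,2)] compose_def using assms(3)
    by (auto simp: unip_def hyp_space_def algebra_simps intro!: restrict_ext)
qed

text \<open>
  The element \<open>\<sigma> \<and> \<tau>\<close> of the exterior square of the radical, acting by contraction on functionals.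
\<close>

definition wedge :: "'v::euclidean_space \<Rightarrow> 'v \<Rightarrow> ('v \<Rightarrow>\<^sub>L real) \<Rightarrow>\<^sub>L 'v" where
  "wedge \<sigma> \<tau> = Blinfun (\<lambda>f. blinfun_apply f \<sigma> *\<^sub>R \<tau> - blinfun_apply f \<tau> *\<^sub>R \<sigma>)"

lemma wedge_apply [simp]:
  "blinfun_apply (wedge \<sigma> \<tau>) f = blinfun_apply f \<sigma> *\<^sub>R \<tau> - blinfun_apply f \<tau> *\<^sub>R \<sigma>"
  unfolding wedge_def
  by (subst bounded_linear_Blinfun_apply) (auto intro!: bounded_linear_intros)

lemma wedge_add_left: "wedge (x + y) z = wedge x z + wedge y z"
  and wedge_add_right: "wedge z (x + y) = wedge z x + wedge z y"
  and wedge_scale_left: "wedge (r *\<^sub>R x) z = r *\<^sub>R wedge x z"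
  and wedge_scale_right: "wedge x (r *\<^sub>R z) = r *\<^sub>R wedge x z"
  and wedge_diff_left: "wedge (x - y) z = wedge x z - wedge y z"
  and wedge_diff_right: "wedge z (x - y) = wedge z x - wedge z y"
  and wedge_zero_left [simp]: "wedge 0 z = 0"
  and wedge_zero_right [simp]: "wedge z 0 = 0"
  and wedge_self [simp]: "wedge z z = 0"
  and wedge_swap: "wedge x z = - wedge z x"
  by (auto intro!: blinfun_eqI simp: blinfun.bilinear_simps algebra_simps)

lemma wedge_sum_left: "wedge (sum g A) z = (\<Sum>i\<in>A. wedge (g i) z)"
  by (induction A rule: infinite_finite_induct) (auto simp: wedge_add_left)

lemma wedge_sum_right: "wedge z (sum g A) = (\<Sum>i\<in>A. wedge z (g i))"
  by (induction A rule: infinite_finite_induct) (auto simp: wedge_add_right)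

abbreviation shear :: "'v::euclidean_space set \<Rightarrow> (('v \<Rightarrow>\<^sub>L real) \<Rightarrow>\<^sub>L 'v) \<Rightarrow> 'v hyp \<Rightarrow> 'v hyp" where
  "shear U D \<equiv> unip U (\<lambda>_. 0) (blinfun_apply D)"

lemma shear_in_GL: "shear U D \<in> carrier (hyp_GL U)"
  by (rule unip_in_GL) (auto simp: linear_iff blinfun.bilinear_simps)

lemma shear_mult: "shear U D \<otimes>\<^bsub>hyp_GL U\<^esub> shear U E = shear U (D + E)"
  by (subst unip_mult)
    (auto simp: shear_in_GL linear_iff blinfun.bilinear_simps intro!: unip_cong)

lemma shear_zero: "shear U 0 = \<one>\<^bsub>hyp_GL U\<^esub>"
  by (auto simp: unip_def GL_one intro!: restrict_ext)

lemma shear_inv: "inv\<^bsub>hyp_GL U\<^esub> (shear U D) = shear U (- D)"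
  by (rule group.inv_equality[OF group_hyp_GL]) (simp_all add: shear_in_GL shear_mult shear_zero)

text \<open>
  Shears compose by adding their parameters. This turns every statement about groups generated by the
  \<open>c\<close>'s and \<open>z\<close>'s into one about integral spans.
\<close>

lemma generate_shear: "generate (hyp_GL U) (shear U ` A) = shear U ` int_module.span A"
proof
  interpret G: group "hyp_GL U" by (rule group_hyp_GL)
  show "generate (hyp_GL U) (shear U ` A) \<subseteq> shear U ` int_module.span A"
  proof
    fix g assume "g \<in> generate (hyp_GL U) (shear U ` A)"
    then show "g \<in> shear U ` int_module.span A"
    proof induction
      case one
      then show ?case by (metis shear_zero imageI int_module.span_zero)
    next
      case (incl h)
      then show ?case by (auto intro: int_module.span_base)
    next
      case (inv h)
      then show ?case
        by (auto simp: shear_inv intro!: imageI int_module.span_neg[OF int_module.span_base])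
    next
      case (eng h1 h2)
      then show ?case by (auto simp: shear_mult intro!: imageI int_module.span_add)
    qed
  qed
  have sg: "subgroup (generate (hyp_GL U) (shear U ` A)) (hyp_GL U)"
    by (rule G.generate_is_subgroup) (auto simp: shear_in_GL)
  have "int_module.span A \<subseteq> {D. shear U D \<in> generate (hyp_GL U) (shear U ` A)}"
  proof (rule int_span_subset)
    fix D E assume "D \<in> {D. shear U D \<in> generate (hyp_GL U) (shear U ` A)}"
      "E \<in> {D. shear U D \<in> generate (hyp_GL U) (shear U ` A)}"
    then have "shear U D \<otimes>\<^bsub>hyp_GL U\<^esub> inv\<^bsub>hyp_GL U\<^esub> (shear U E) \<in> generate (hyp_GL U) (shear U ` A)"
      using sg by (auto intro: subgroup.m_closed subgroup.m_inv_closed)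
    then show "D - E \<in> {D. shear U D \<in> generate (hyp_GL U) (shear U ` A)}"
      by (simp add: shear_inv shear_mult)
  qed (use sg in \<open>auto simp: shear_zero intro: generate.intros subgroup.one_closed\<close>)
  then show "shear U ` int_module.span A \<subseteq> generate (hyp_GL U) (shear U ` A)" by auto
qed


section \<open>Simply laced finite root systems\<close>

lemma independent_indexedD:
  fixes a :: "nat \<Rightarrow> 'a::real_vector"
  assumes "inj_on a I" "independent (a ` I)" "finite I" "(\<Sum>i\<in>I. c i *\<^sub>R a i) = 0" "i \<in> I"
  shows "c i = 0"
proof -
  have "(\<Sum>v\<in>a ` I. c (the_inv_into I a v) *\<^sub>R v) = (\<Sum>i\<in>I. c i *\<^sub>R a i)"
    by (subst sum.reindex[OF assms(1)]) (simp add: the_inv_into_f_f[OF assms(1)])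
  then have "c (the_inv_into I a (a i)) = 0"
    using assms independentD[of "a ` I" "a ` I" "\<lambda>v. c (the_inv_into I a v)" "a i"] by auto
  then show ?thesis by (simp add: the_inv_into_f_f[OF assms(1,5)])
qed

text \<open>
  Simple lacing is encoded by a fundamental system of vectors of norm 2, which forces norm 2 on all
  nonzero elements of \<open>D\<close>.
\<close>

locale simply_laced_part =
  fixes B :: "'v::euclidean_space \<Rightarrow> 'v \<Rightarrow> real" and U D :: "'v set"
    and l :: nat and a :: "nat \<Rightarrow> 'v"
  assumes psd: "psd_form B"
    and compl: "complement_of (form_radical B) U"
    and roots: "finite_root_system B U D"
    and fund: "fundamental_system D l a"
    and norm_simple: "\<And>i. i \<in> {1..l} \<Longrightarrow> B (a i) (a i) = 2"
begin

abbreviation "V0 \<equiv> form_radical B"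

lemma bilinear_B: "bilinear B"
  and B_sym: "B x y = B y x"
  using psd by (auto simp: psd_form_def)

lemma B_add_left: "B (x + y) z = B x z + B y z"
  and B_add_right: "B z (x + y) = B z x + B z y"
  and B_diff_left: "B (x - y) z = B x z - B y z"
  and B_diff_right: "B z (x - y) = B z x - B z y"
  and B_scale_left: "B (r *\<^sub>R x) z = r * B x z"
  and B_scale_right: "B z (r *\<^sub>R x) = r * B z x"
  and B_minus_left: "B (- x) z = - B x z"
  and B_minus_right: "B z (- x) = - B z x"
  and B_zero_left: "B 0 z = 0"
  and B_zero_right: "B z 0 = 0"
  using bilinear_B
  by (simp_all add: bilinear_ladd bilinear_radd bilinear_lsub bilinear_rsub bilinear_lmul
      bilinear_rmul bilinear_lneg bilinear_rneg bilinear_lzero bilinear_rzero)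

lemma B_sum_left: "B (sum g A) z = (\<Sum>i\<in>A. B (g i) z)"
  by (induction A rule: infinite_finite_induct) (auto simp: B_add_left B_zero_left)

lemma B_sum_right: "B z (sum g A) = (\<Sum>i\<in>A. B z (g i))"
  by (induction A rule: infinite_finite_induct) (auto simp: B_add_right B_zero_right)

lemmas B_simps = B_add_left B_add_right B_diff_left B_diff_right B_scale_left B_scale_right
  B_minus_left B_minus_right B_zero_left B_zero_right

lemma B_radical: "x \<in> V0 \<Longrightarrow> B x y = 0" "x \<in> V0 \<Longrightarrow> B y x = 0"
  using B_sym by (auto simp: form_radical_def)

lemma subspace_radical: "subspace V0"
  by (auto simp: subspace_def form_radical_def B_simps)

lemma subspace_U: "subspace U"
  using compl by (simp add: complement_of_def)

lemma U_radical: "x \<in> U \<Longrightarrow> x \<in> V0 \<Longrightarrow> x = 0"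
  using compl by (auto simp: complement_of_def)

lemma B_pos: "x \<in> U \<Longrightarrow> x \<noteq> 0 \<Longrightarrow> 0 < B x x"
  using roots by (simp add: finite_root_system_def)

lemma D_subset_U: "D \<subseteq> U"
  using roots span_superset by (auto simp: finite_root_system_def)

lemma simple_in_D: "i \<in> {1..l} \<Longrightarrow> a i \<in> D"
  using fund by (auto simp: fundamental_system_def)

lemma simple_in_U: "i \<in> {1..l} \<Longrightarrow> a i \<in> U"
  using simple_in_D D_subset_U by auto

lemma simple_independent: "(\<Sum>i\<in>{1..l}. c i *\<^sub>R a i) = 0 \<Longrightarrow> i \<in> {1..l} \<Longrightarrow> c i = 0"
  using fund independent_indexedD[of a "{1..l}" c i] by (auto simp: fundamental_system_def)

lemma simple_coeff_unique:
  assumes "(\<Sum>i\<in>{1..l}. c i *\<^sub>R a i) = (\<Sum>i\<in>{1..l}. d i *\<^sub>R a i)" "i \<in> {1..l}"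
  shows "c i = d i"
proof -
  have "(\<Sum>i\<in>{1..l}. (c i - d i) *\<^sub>R a i) = 0"
    using assms(1) by (simp add: scaleR_left_diff_distrib sum_subtractf)
  from simple_independent[OF this assms(2)] show ?thesis by simp
qed

lemma root_nat_coords:
  assumes "\<beta> \<in> D"
  obtains k :: "nat \<Rightarrow> nat" where "\<beta> = (\<Sum>i\<in>{1..l}. real (k i) *\<^sub>R a i) \<or>
    \<beta> = - (\<Sum>i\<in>{1..l}. real (k i) *\<^sub>R a i)"
  using fund assms unfolding fundamental_system_def by blast

lemma root_reflect:
  assumes "\<beta> \<in> D" "\<beta> \<noteq> 0" "\<gamma> \<in> D"
  shows "B \<gamma> (coroot B \<beta>) \<in> \<int>" "\<gamma> - B \<gamma> (coroot B \<beta>) *\<^sub>R \<beta> \<in> D"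
  using assms roots by (auto simp: finite_root_system_def)

lemma root_not_double: "\<beta> \<in> D \<Longrightarrow> \<beta> \<noteq> 0 \<Longrightarrow> 2 *\<^sub>R \<beta> \<notin> D"
  using roots by (auto simp: finite_root_system_def)

lemma simple_nonzero: "i \<in> {1..l} \<Longrightarrow> a i \<noteq> 0"
  using norm_simple B_zero_left by fastforce

text \<open>
  Integrality of the pairing with the coroot leaves only the factors 1 and 2, and \<open>D\<close> is reduced.
\<close>

lemma multiple_of_simple_root:
  assumes "i \<in> {1..l}" "real k *\<^sub>R a i \<in> D" "k \<noteq> 0"
  shows "k = 1"
proof -
  have "B (a i) (coroot B (real k *\<^sub>R a i)) = 2 / real k"
    using assms norm_simple[OF assms(1)] by (simp add: coroot_def B_simps)
  then have "2 / real k \<in> \<int>"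
    using root_reflect(1)[OF assms(2) _ simple_in_D[OF assms(1)]] simple_nonzero assms by simp
  then obtain m :: int where "2 / real k = of_int m" by (auto elim: Ints_cases)
  then have "2 = of_int m * real k" using assms(3) by (simp add: field_simps)
  then have "of_int 2 = (of_int (m * int k) :: real)" by simp
  then have "int k dvd 2" by (metis dvd_triv_right of_int_eq_iff)
  then have "int k \<le> 2" by (rule zdvd_imp_le) simp
  then have "k = 1 \<or> k = 2" using assms(3) by auto
  then show ?thesis
    using root_not_double[OF simple_in_D[OF assms(1)] simple_nonzero[OF assms(1)]] assms(2) by auto
qed

text \<open>
  Every positive root is conjugate to a simple one under the Weyl group, hence has the same norm as a
  simple root. The induction is on the height: a positive root pairs positively with some simple root
  occurring in it, and reflecting in that simple root lowers the height, unless the root is itself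
  simple.
\<close>

lemma positive_root_norm:
  assumes "\<beta> = (\<Sum>i\<in>{1..l}. real (k i) *\<^sub>R a i)" "\<beta> \<in> D" "\<beta> \<noteq> 0"
  shows "B \<beta> \<beta> = 2"
  using assms
proof (induction "\<Sum>i\<in>{1..l}. k i" arbitrary: k \<beta> rule: less_induct)
  case less
  have "0 < B \<beta> \<beta>" using B_pos less.prems D_subset_U by auto
  also have "B \<beta> \<beta> = (\<Sum>i\<in>{1..l}. real (k i) * B \<beta> (a i))"
    by (subst (2) less.prems(1)) (simp add: B_sum_right B_simps)
  finally obtain i where i: "i \<in> {1..l}" "0 < real (k i) * B \<beta> (a i)"
    by (metis (no_types, lifting) linorder_not_less sum_nonpos)
  then have ki: "k i > 0" and pos: "B \<beta> (a i) > 0"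
    by (auto simp: zero_less_mult_iff)
  have co: "coroot B (a i) = a i" using norm_simple[OF i(1)] by (simp add: coroot_def)
  define \<gamma> where "\<gamma> = \<beta> - B \<beta> (a i) *\<^sub>R a i"
  have \<gamma>D: "\<gamma> \<in> D" and int: "B \<beta> (a i) \<in> \<int>"
    using root_reflect[OF simple_in_D[OF i(1)] simple_nonzero[OF i(1)] less.prems(2)]
    by (simp_all add: co \<gamma>_def)
  obtain c :: int where c: "B \<beta> (a i) = of_int c" using int by (auto elim: Ints_cases)
  have norm: "B \<gamma> \<gamma> = B \<beta> \<beta>"
    using norm_simple[OF i(1)] by (simp add: \<gamma>_def B_simps B_sym algebra_simps)
  then have \<gamma>0: "\<gamma> \<noteq> 0"
    using \<open>0 < B \<beta> \<beta>\<close> by (auto simp: B_simps)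
  have \<gamma>_coords: "\<gamma> = (\<Sum>j\<in>{1..l}. (real (k j) - (if j = i then of_int c else 0)) *\<^sub>R a j)"
    using i(1) unfolding \<gamma>_def c
    by (subst less.prems(1))
      (simp add: scaleR_left_diff_distrib sum_subtractf if_distrib[of "\<lambda>r. r *\<^sub>R _"] cong: if_cong)
  obtain m :: "nat \<Rightarrow> nat" where m: "\<gamma> = (\<Sum>j\<in>{1..l}. real (m j) *\<^sub>R a j) \<or>
      \<gamma> = - (\<Sum>j\<in>{1..l}. real (m j) *\<^sub>R a j)"
    using root_nat_coords[OF \<gamma>D] .
  then show ?case
  proof
    assume \<gamma>m: "\<gamma> = (\<Sum>j\<in>{1..l}. real (m j) *\<^sub>R a j)"
    have mk: "real (m j) = real (k j) - (if j = i then of_int c else 0)" if "j \<in> {1..l}" for j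
      using simple_coeff_unique[OF _ that] \<gamma>m \<gamma>_coords by metis
    have "(\<Sum>j\<in>{1..l}. m j) < (\<Sum>j\<in>{1..l}. k j)"
    proof (rule sum_strict_mono_ex1)
      show "\<forall>j\<in>{1..l}. m j \<le> k j"
      proof
        fix j assume "j \<in> {1..l}"
        from mk[OF this] pos c show "m j \<le> k j" by (simp split: if_splits)
      qed
      show "\<exists>j\<in>{1..l}. m j < k j"
        using mk[OF i(1)] pos c i(1) by (intro bexI[of _ i]) auto
    qed simp
    from less.hyps[OF this \<gamma>m \<gamma>D \<gamma>0] norm show ?thesis by simp
  next
    \<comment> \<open>If the reflection is negative, only the coefficient at \<open>i\<close> can have been nonzero.\<close>
    assume "\<gamma> = - (\<Sum>j\<in>{1..l}. real (m j) *\<^sub>R a j)"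
    then have \<gamma>m: "\<gamma> = (\<Sum>j\<in>{1..l}. (- real (m j)) *\<^sub>R a j)"
      by (simp add: sum_negf)
    have "k j = 0" if "j \<in> {1..l}" "j \<noteq> i" for j
    proof -
      have "- real (m j) = real (k j) - (if j = i then of_int c else 0)"
        using simple_coeff_unique[OF _ that(1)] \<gamma>m \<gamma>_coords by metis
      then show ?thesis using that(2) by simp
    qed
    then have "\<beta> = (\<Sum>j\<in>{1..l}. if j = i then real (k i) *\<^sub>R a i else 0)"
      unfolding less.prems(1) by (intro sum.cong) auto
    then have \<beta>: "\<beta> = real (k i) *\<^sub>R a i" using i(1) by simp
    then have "k i = 1"
      using multiple_of_simple_root[OF i(1)] less.prems(2) ki by simp
    then show ?thesis using \<beta> norm_simple[OF i(1)] by simp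
  qed
qed

lemma neg_root: "\<beta> \<in> D \<Longrightarrow> - \<beta> \<in> D"
proof (cases "\<beta> = 0")
  case False
  assume \<beta>: "\<beta> \<in> D"
  then have "B \<beta> \<beta> \<noteq> 0" using False B_pos D_subset_U by fastforce
  then have "B \<beta> (coroot B \<beta>) = 2" by (simp add: coroot_def B_simps)
  then show ?thesis using root_reflect(2)[OF \<beta> False \<beta>] by (simp add: scaleR_2)
qed simp

lemma root_norm:
  assumes "\<beta> \<in> D" "\<beta> \<noteq> 0"
  shows "B \<beta> \<beta> = 2"
proof -
  obtain k where "\<beta> = (\<Sum>i\<in>{1..l}. real (k i) *\<^sub>R a i) \<or> \<beta> = - (\<Sum>i\<in>{1..l}. real (k i) *\<^sub>R a i)"
    using root_nat_coords[OF assms(1)] .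
  then show ?thesis
  proof
    assume "\<beta> = - (\<Sum>i\<in>{1..l}. real (k i) *\<^sub>R a i)"
    then have "- \<beta> = (\<Sum>i\<in>{1..l}. real (k i) *\<^sub>R a i)" by simp
    from positive_root_norm[OF this] show ?thesis
      using assms neg_root by (simp add: B_simps)
  qed (use positive_root_norm assms in blast)
qed

lemma root_int_coords:
  assumes "\<beta> \<in> D"
  obtains k :: "nat \<Rightarrow> int" where "\<beta> = (\<Sum>i\<in>{1..l}. of_int (k i) *\<^sub>R a i)"
proof -
  obtain k where "\<beta> = (\<Sum>i\<in>{1..l}. real (k i) *\<^sub>R a i) \<or> \<beta> = - (\<Sum>i\<in>{1..l}. real (k i) *\<^sub>R a i)"
    using root_nat_coords[OF assms] .
  then show ?thesis
    using that[of "\<lambda>i. int (k i)"] that[of "\<lambda>i. - int (k i)"] by (auto simp: sum_negf)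
qed

lemma simple_pairing_int:
  assumes "i \<in> {1..l}" "j \<in> {1..l}"
  shows "B (a i) (a j) \<in> \<int>"
  using root_reflect(1)[OF simple_in_D[OF assms(2)] simple_nonzero[OF assms(2)] simple_in_D[OF assms(1)]]
    norm_simple[OF assms(2)] by (simp add: coroot_def)


section \<open>Coordinates on the Heisenberg-like group\<close>

text \<open>
  The integral matrix \<open>h\<close> with \<open>h + h\<^sup>T\<close> the Gram matrix of the simple roots. The diagonal entry 1 is
  half the norm of a simple root.
\<close>

definition half :: "nat \<Rightarrow> nat \<Rightarrow> real" where
  "half i j = (if i < j then B (a i) (a j) else if i = j then 1 else 0)"

lemma half_add_swap: "i \<in> {1..l} \<Longrightarrow> j \<in> {1..l} \<Longrightarrow> half i j + half j i = B (a i) (a j)"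
  using norm_simple[of i] B_sym by (auto simp: half_def)

lemma half_int: "i \<in> {1..l} \<Longrightarrow> j \<in> {1..l} \<Longrightarrow> half i j \<in> \<int>"
  using simple_pairing_int by (auto simp: half_def)

lemma half_bilinear_add_swap:
  "(\<Sum>i\<in>{1..l}. \<Sum>j\<in>{1..l}. half i j * p j * q i) + (\<Sum>i\<in>{1..l}. \<Sum>j\<in>{1..l}. half i j * q j * p i)
   = B (\<Sum>i\<in>{1..l}. p i *\<^sub>R a i) (\<Sum>i\<in>{1..l}. q i *\<^sub>R a i)"
proof -
  have "(\<Sum>i\<in>{1..l}. \<Sum>j\<in>{1..l}. half i j * p j * q i) = (\<Sum>i\<in>{1..l}. \<Sum>j\<in>{1..l}. half j i * p i * q j)"
    by (rule sum.swap)
  then have "(\<Sum>i\<in>{1..l}. \<Sum>j\<in>{1..l}. half i j * p j * q i) + (\<Sum>i\<in>{1..l}. \<Sum>j\<in>{1..l}. half i j * q j * p i)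
    = (\<Sum>i\<in>{1..l}. \<Sum>j\<in>{1..l}. (half i j + half j i) * p i * q j)"
    by (simp add: sum.distrib algebra_simps)
  also have "\<dots> = (\<Sum>i\<in>{1..l}. \<Sum>j\<in>{1..l}. p i * (q j * B (a i) (a j)))"
    by (intro sum.cong refl) (simp add: half_add_swap)
  also have "\<dots> = B (\<Sum>i\<in>{1..l}. p i *\<^sub>R a i) (\<Sum>i\<in>{1..l}. q i *\<^sub>R a i)"
    unfolding B_sum_left B_scale_left unfolding B_sum_right B_scale_right
    by (simp add: sum_distrib_left)
  finally show ?thesis .
qed

text \<open>
  The ordered product of the \<open>T_map B U (a i) (x i)\<close> for \<open>i = 1, ..., l\<close>, followed by a shear. The quadratic term in \<open>x\<close> uses
  \<open>half\<close> rather than half of the Gram matrix, so that the cocycle has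
  integral coefficients.
\<close>

definition heis :: "(nat \<Rightarrow> 'v) \<Rightarrow> (('v \<Rightarrow>\<^sub>L real) \<Rightarrow>\<^sub>L 'v) \<Rightarrow> 'v hyp \<Rightarrow> 'v hyp" where
  "heis x E = unip U (\<lambda>v. \<Sum>i\<in>{1..l}. B (a i) v *\<^sub>R x i)
     (\<lambda>f. blinfun_apply E f - (\<Sum>i\<in>{1..l}. blinfun_apply f (x i) *\<^sub>R a i)
        - (\<Sum>i\<in>{1..l}. \<Sum>j\<in>{1..l}. (half i j * blinfun_apply f (x j)) *\<^sub>R x i))"

definition radical_valued :: "(nat \<Rightarrow> 'v) \<Rightarrow> (('v \<Rightarrow>\<^sub>L real) \<Rightarrow>\<^sub>L 'v) \<Rightarrow> bool" where
  "radical_valued x E \<longleftrightarrow> (\<forall>i\<in>{1..l}. x i \<in> V0) \<and> (\<forall>f. blinfun_apply E f \<in> V0)"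

text \<open>
  The cocycle of the central extension of the additive group of tuples \<open>x\<close> that is formed by the \<open>heis x E\<close>.
\<close>

definition cocycle :: "(nat \<Rightarrow> 'v) \<Rightarrow> (nat \<Rightarrow> 'v) \<Rightarrow> ('v \<Rightarrow>\<^sub>L real) \<Rightarrow>\<^sub>L 'v" where
  "cocycle x y = (\<Sum>i\<in>{1..l}. \<Sum>j\<in>{1..l}. half i j *\<^sub>R wedge (x j) (y i))"

lemma blinfun_sum_apply: "blinfun_apply (sum g A) f = (\<Sum>i\<in>A. blinfun_apply (g i) f)"
  by (induction A rule: infinite_finite_induct) (auto simp: blinfun.bilinear_simps)

lemma linear_heis_parts:
  "linear (\<lambda>v. \<Sum>i\<in>{1..l}. B (a i) v *\<^sub>R x i)"
  "linear (\<lambda>f. blinfun_apply E f - (\<Sum>i\<in>{1..l}. blinfun_apply f (x i) *\<^sub>R a i)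
        - (\<Sum>i\<in>{1..l}. \<Sum>j\<in>{1..l}. (half i j * blinfun_apply f (x j)) *\<^sub>R x i))"
  by (auto simp: linear_iff blinfun.bilinear_simps B_simps algebra_simps sum.distrib scaleR_sum_right)

lemma heis_in_GL:
  assumes "\<forall>i\<in>{1..l}. x i \<in> V0"
  shows "heis x E \<in> carrier (hyp_GL U)"
  unfolding heis_def
  by (rule unip_in_GL[OF linear_heis_parts]) (auto simp: B_sum_right B_simps B_radical assms intro!: sum.neutral)

text \<open>
  Two factors contribute \<open>- (a\<^sub>i, a\<^sub>j) f(y\<^sub>j) x\<^sub>i\<close> from the composition, whereas the quadratic term of \<open>x + y\<close>
  contributes the \<open>h\<close>-weighted mixed terms. Splitting \<open>(a\<^sub>i, a\<^sub>j)\<close> into \<open>h\<^sub>i\<^sub>j + h\<^sub>j\<^sub>i\<close> and exchanging the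
  summation indices in one half leaves exactly the wedges of the cocycle. The range
  condition on \<open>F\<close> makes \<open>F f\<close> invisible to the linear part of the left factor.
\<close>

lemma heis_mult:
  assumes x: "\<forall>i\<in>{1..l}. x i \<in> V0" and y: "\<forall>i\<in>{1..l}. y i \<in> V0"
    and F: "\<And>f. blinfun_apply F f \<in> V0"
  shows "heis x E \<otimes>\<^bsub>hyp_GL U\<^esub> heis y F = heis (\<lambda>i. x i + y i) (E + F + cocycle x y)"
proof -
  let ?I = "{1..l}"
  have PP: "(\<Sum>i\<in>?I. B (a i) (\<Sum>i\<in>?I. B (a i) v *\<^sub>R y i) *\<^sub>R x i) = 0" for v
    using y by (simp add: B_sum_right B_simps B_radical)
  have PQ: "(\<Sum>i\<in>?I. B (a i) (blinfun_apply F f - (\<Sum>i\<in>?I. blinfun_apply f (y i) *\<^sub>R a i)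
        - (\<Sum>i\<in>?I. \<Sum>j\<in>?I. (half i j * blinfun_apply f (y j)) *\<^sub>R y i)) *\<^sub>R x i)
      = - (\<Sum>i\<in>?I. \<Sum>j\<in>?I. (half i j * blinfun_apply f (y j)) *\<^sub>R x i)
        - (\<Sum>i\<in>?I. \<Sum>j\<in>?I. (half i j * blinfun_apply f (y i)) *\<^sub>R x j)" for f
  proof -
    have "B (a i) (blinfun_apply F f - (\<Sum>i\<in>?I. blinfun_apply f (y i) *\<^sub>R a i)
        - (\<Sum>i\<in>?I. \<Sum>j\<in>?I. (half i j * blinfun_apply f (y j)) *\<^sub>R y i)) *\<^sub>R x i
      = - (\<Sum>j\<in>?I. (half i j * blinfun_apply f (y j)) *\<^sub>R x i)
        - (\<Sum>j\<in>?I. (half j i * blinfun_apply f (y j)) *\<^sub>R x i)" if "i \<in> ?I" for i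
    proof -
      have "B (a i) (blinfun_apply F f - (\<Sum>i\<in>?I. blinfun_apply f (y i) *\<^sub>R a i)
        - (\<Sum>i\<in>?I. \<Sum>j\<in>?I. (half i j * blinfun_apply f (y j)) *\<^sub>R y i)) =
        - (\<Sum>j\<in>?I. blinfun_apply f (y j) * B (a i) (a j))"
        using y F by (simp add: B_sum_right B_simps B_radical)
      also have "\<dots> = - (\<Sum>j\<in>?I. blinfun_apply f (y j) * (half i j + half j i))"
        using that by (simp add: half_add_swap)
      finally have eq: "B (a i) (blinfun_apply F f - (\<Sum>i\<in>?I. blinfun_apply f (y i) *\<^sub>R a i)
        - (\<Sum>i\<in>?I. \<Sum>j\<in>?I. (half i j * blinfun_apply f (y j)) *\<^sub>R y i)) =
        - (\<Sum>j\<in>?I. blinfun_apply f (y j) * (half i j + half j i))" .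
      show ?thesis
        unfolding eq by (simp add: scaleR_sum_left sum.distrib algebra_simps)
    qed
    then have "(\<Sum>i\<in>?I. B (a i) (blinfun_apply F f - (\<Sum>i\<in>?I. blinfun_apply f (y i) *\<^sub>R a i)
        - (\<Sum>i\<in>?I. \<Sum>j\<in>?I. (half i j * blinfun_apply f (y j)) *\<^sub>R y i)) *\<^sub>R x i)
      = - (\<Sum>i\<in>?I. \<Sum>j\<in>?I. (half i j * blinfun_apply f (y j)) *\<^sub>R x i)
        - (\<Sum>i\<in>?I. \<Sum>j\<in>?I. (half j i * blinfun_apply f (y j)) *\<^sub>R x i)"
      by (simp add: sum_subtractf sum_negf)
    also have "(\<Sum>i\<in>?I. \<Sum>j\<in>?I. (half j i * blinfun_apply f (y j)) *\<^sub>R x i) =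
        (\<Sum>i\<in>?I. \<Sum>j\<in>?I. (half i j * blinfun_apply f (y i)) *\<^sub>R x j)"
      by (rule sum.swap)
    finally show ?thesis .
  qed
  show ?thesis
    unfolding heis_def
    apply (subst unip_mult)
    subgoal using heis_in_GL[OF x, of E] by (simp add: heis_def)
    subgoal using heis_in_GL[OF y, of F] by (simp add: heis_def)
    subgoal by (rule linear_heis_parts)
    subgoal
      unfolding PP PQ
      by (rule unip_cong)
        (simp_all add: cocycle_def blinfun_sum_apply blinfun.bilinear_simps sum.distrib sum_subtractf
          algebra_simps)
    done
qed

lemma heis_zero:
  assumes "\<forall>i\<in>{1..l}. x i = 0"
  shows "heis x E = shear U E"
  unfolding heis_def using assms by (intro unip_cong) (auto simp: blinfun.bilinear_simps)

lemma T_map_unip: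
  assumes "\<beta> \<in> U" "\<sigma> \<in> V0"
  shows "T_map B U \<beta> \<sigma> = unip U (\<lambda>v. B \<beta> v *\<^sub>R \<sigma>)
    (\<lambda>f. - (blinfun_apply f \<sigma> *\<^sub>R \<beta>) - (B \<beta> \<beta> / 2 * blinfun_apply f \<sigma>) *\<^sub>R \<sigma>)"
  using assms
  by (auto simp: T_map_def unip_def hyp_form_def emb_def hyp_space_def B_radical intro!: restrict_ext)

lemma T_map_radical:
  assumes "\<tau> \<in> V0" "\<sigma> \<in> V0"
  shows "T_map B U \<tau> \<sigma> = shear U (wedge \<tau> \<sigma>)"
  using assms
  by (auto simp: T_map_def unip_def hyp_form_def emb_def hyp_space_def B_radical intro!: restrict_ext)

text \<open>
  Proportional tuples need no correction: the quadratic term is \<open>\<Sum> h\<^sub>i\<^sub>j k\<^sub>i k\<^sub>j = (\<beta>, \<beta>) / 2\<close> times the one in the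
  definition of \<open>T_map\<close>.
\<close>

lemma T_map_heis:
  assumes \<beta>: "\<beta> = (\<Sum>i\<in>{1..l}. of_int (k i) *\<^sub>R a i)" and \<sigma>: "\<sigma> \<in> V0"
  shows "T_map B U \<beta> \<sigma> = heis (\<lambda>i. of_int (k i) *\<^sub>R \<sigma>) 0"
proof -
  have U: "\<beta> \<in> U"
    unfolding \<beta> by (intro subspace_sum subspace_scale subspace_U simple_in_U)
  have q: "(\<Sum>i\<in>{1..l}. \<Sum>j\<in>{1..l}. half i j * of_int (k j) * of_int (k i)) = B \<beta> \<beta> / 2"
    using half_bilinear_add_swap[of "\<lambda>i. of_int (k i)" "\<lambda>i. of_int (k i)"] by (simp add: \<beta>)
  show ?thesis
    unfolding T_map_unip[OF U \<sigma>] heis_def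
  proof (rule unip_cong)
    show "B \<beta> v *\<^sub>R \<sigma> = (\<Sum>i\<in>{1..l}. B (a i) v *\<^sub>R of_int (k i) *\<^sub>R \<sigma>)" for v
      by (simp add: \<beta> B_sum_left B_simps scaleR_sum_left mult.commute)
  next
    fix f :: "'v \<Rightarrow>\<^sub>L real"
    have "(\<Sum>i\<in>{1..l}. \<Sum>j\<in>{1..l}. (half i j * blinfun_apply f (of_int (k j) *\<^sub>R \<sigma>)) *\<^sub>R of_int (k i) *\<^sub>R \<sigma>)
      = (B \<beta> \<beta> / 2 * blinfun_apply f \<sigma>) *\<^sub>R \<sigma>"
      unfolding q[symmetric]
      by (simp add: scaleR_sum_left[symmetric] sum_distrib_left sum_distrib_right
          blinfun.bilinear_simps mult_ac)
    moreover have "(\<Sum>i\<in>{1..l}. blinfun_apply f (of_int (k i) *\<^sub>R \<sigma>) *\<^sub>R a i) = blinfun_apply f \<sigma> *\<^sub>R \<beta>"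
      by (simp add: \<beta> scaleR_sum_right blinfun.bilinear_simps mult.commute)
    ultimately show "- (blinfun_apply f \<sigma> *\<^sub>R \<beta>) - (B \<beta> \<beta> / 2 * blinfun_apply f \<sigma>) *\<^sub>R \<sigma> =
        blinfun_apply 0 f - (\<Sum>i\<in>{1..l}. blinfun_apply f (of_int (k i) *\<^sub>R \<sigma>) *\<^sub>R a i) -
        (\<Sum>i\<in>{1..l}. \<Sum>j\<in>{1..l}. (half i j * blinfun_apply f (of_int (k j) *\<^sub>R \<sigma>)) *\<^sub>R of_int (k i) *\<^sub>R \<sigma>)"
      by simp
  qed
qed

lemma cocycle_scaled:
  "cocycle (\<lambda>i. p i *\<^sub>R \<sigma>) (\<lambda>i. q i *\<^sub>R \<tau>) =
    (\<Sum>i\<in>{1..l}. \<Sum>j\<in>{1..l}. half i j * p j * q i) *\<^sub>R wedge \<sigma> \<tau>"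
  by (simp add: cocycle_def wedge_scale_left wedge_scale_right scaleR_sum_left mult_ac)

lemma wedge_radical: "\<sigma> \<in> V0 \<Longrightarrow> \<tau> \<in> V0 \<Longrightarrow> blinfun_apply (wedge \<sigma> \<tau>) f \<in> V0"
  by (simp add: subspace_diff subspace_scale subspace_radical)

lemma cocycle_radical:
  assumes "\<forall>i\<in>{1..l}. x i \<in> V0" "\<forall>i\<in>{1..l}. y i \<in> V0"
  shows "blinfun_apply (cocycle x y) f \<in> V0"
  unfolding cocycle_def blinfun_sum_apply scaleR_blinfun.rep_eq
  using assms by (intro subspace_sum subspace_scale subspace_radical wedge_radical) auto

end


section \<open>Generators of the Heisenberg-like group\<close>

locale heisenberg_setup = simply_laced_part B U "finite_part B U R" l a
  for B :: "'v::euclidean_space \<Rightarrow> 'v \<Rightarrow> real" and U R :: "'v set" and l a +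
  fixes S :: "'v set"
  assumes semi: "semilattice_in (form_radical B) S"
    and R_eq: "R = (S + S) \<union> (finite_part B U R + S)"
begin

abbreviation "D \<equiv> finite_part B U R"
abbreviation "H \<equiv> heisenberg_group B U R"
abbreviation "\<Lambda> \<equiv> int_module.span S"

lemma S_radical: "\<sigma> \<in> S \<Longrightarrow> \<sigma> \<in> V0"
  and S_zero: "0 \<in> S"
  and S_span: "span S = V0"
  using semi by (auto simp: semilattice_in_def)

lemma S_neg:
  assumes "\<sigma> \<in> S"
  shows "- \<sigma> \<in> S"
proof -
  have "\<sigma> - 2 *\<^sub>R \<sigma> \<in> S" using semi assms by (auto simp: semilattice_in_def)
  then show ?thesis by (simp add: scaleR_2)
qed

lemma lattice_radical: "\<Lambda> \<subseteq> V0"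
  by (rule int_span_subset) (auto simp: S_radical subspace_0 subspace_diff subspace_radical)

text \<open>
  \<open>S\<close> is a union of cosets of twice the lattice that it generates: the vectors whose doubles translate
  \<open>S\<close> into itself form a group containing \<open>S\<close>.
\<close>

lemma S_add_double:
  assumes "\<sigma> \<in> S" "\<tau> \<in> \<Lambda>"
  shows "\<sigma> + 2 *\<^sub>R \<tau> \<in> S"
proof -
  have "\<Lambda> \<subseteq> {\<tau>. \<forall>\<sigma>\<in>S. \<sigma> + 2 *\<^sub>R \<tau> \<in> S \<and> \<sigma> - 2 *\<^sub>R \<tau> \<in> S}"
  proof (rule int_span_subset)
    show "S \<subseteq> {\<tau>. \<forall>\<sigma>\<in>S. \<sigma> + 2 *\<^sub>R \<tau> \<in> S \<and> \<sigma> - 2 *\<^sub>R \<tau> \<in> S}"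
      using semi by (auto simp: semilattice_in_def)
    fix x y
    assume x: "x \<in> {\<tau>. \<forall>\<sigma>\<in>S. \<sigma> + 2 *\<^sub>R \<tau> \<in> S \<and> \<sigma> - 2 *\<^sub>R \<tau> \<in> S}"
      and y: "y \<in> {\<tau>. \<forall>\<sigma>\<in>S. \<sigma> + 2 *\<^sub>R \<tau> \<in> S \<and> \<sigma> - 2 *\<^sub>R \<tau> \<in> S}"
    have "(\<sigma> + 2 *\<^sub>R x) - 2 *\<^sub>R y \<in> S" "(\<sigma> - 2 *\<^sub>R x) + 2 *\<^sub>R y \<in> S" if "\<sigma> \<in> S" for \<sigma>
      using x y that by blast+
    then show "x - y \<in> {\<tau>. \<forall>\<sigma>\<in>S. \<sigma> + 2 *\<^sub>R \<tau> \<in> S \<and> \<sigma> - 2 *\<^sub>R \<tau> \<in> S}"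
      by (simp add: algebra_simps)
  qed simp
  then show ?thesis using assms by auto
qed

lemma nonisotropic_iff:
  "\<alpha> \<in> nonisotropic B R \<longleftrightarrow> (\<exists>\<beta> \<tau>. \<beta> \<in> D \<and> \<beta> \<noteq> 0 \<and> \<tau> \<in> S \<and> \<alpha> = \<beta> + \<tau>)"
proof
  assume \<alpha>: "\<alpha> \<in> nonisotropic B R"
  then have nz: "B \<alpha> \<alpha> \<noteq> 0" and "\<alpha> \<in> R" by (auto simp: nonisotropic_def)
  then have "\<alpha> \<in> S + S \<or> \<alpha> \<in> D + S" using R_eq by auto
  then show "\<exists>\<beta> \<tau>. \<beta> \<in> D \<and> \<beta> \<noteq> 0 \<and> \<tau> \<in> S \<and> \<alpha> = \<beta> + \<tau>"
  proof
    assume "\<alpha> \<in> S + S"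
    then obtain \<sigma> \<tau> where "\<sigma> \<in> S" "\<tau> \<in> S" "\<alpha> = \<sigma> + \<tau>" by (auto simp: set_plus_def)
    then have "\<alpha> \<in> V0" by (simp add: subspace_add subspace_radical S_radical)
    then show ?thesis using nz B_radical by auto
  next
    assume "\<alpha> \<in> D + S"
    then obtain \<beta> \<tau> where "\<beta> \<in> D" "\<tau> \<in> S" "\<alpha> = \<beta> + \<tau>" by (auto simp: set_plus_def)
    moreover have "\<beta> \<noteq> 0" using calculation nz by (auto simp: B_radical S_radical)
    ultimately show ?thesis by blast
  qed
next
  assume "\<exists>\<beta> \<tau>. \<beta> \<in> D \<and> \<beta> \<noteq> 0 \<and> \<tau> \<in> S \<and> \<alpha> = \<beta> + \<tau>"
  then obtain \<beta> \<tau> where *: "\<beta> \<in> D" "\<beta> \<noteq> 0" "\<tau> \<in> S" "\<alpha> = \<beta> + \<tau>" by blast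
  then have "B \<alpha> \<alpha> = 2" using root_norm by (simp add: B_simps B_radical S_radical)
  moreover have "\<alpha> \<in> R" using * R_eq by (auto simp: set_plus_def)
  ultimately show "\<alpha> \<in> nonisotropic B R" by (simp add: nonisotropic_def)
qed

lemma refl_map_apply:
  assumes "\<beta> \<in> D" "\<beta> \<noteq> 0" "\<tau> \<in> V0" "u \<in> hyp_space U"
  shows "refl_map B U (\<beta> + \<tau>) u =
    (fst u - (B \<beta> (fst u) + blinfun_apply (snd u) \<tau>) *\<^sub>R (\<beta> + \<tau>), snd u)"
proof -
  have "blinfun_apply (snd u) \<beta> = 0"
    using assms D_subset_U by (auto simp: hyp_space_def)
  moreover have "coroot B (\<beta> + \<tau>) = \<beta> + \<tau>"
    using assms root_norm[of \<beta>] by (simp add: coroot_def B_simps B_radical)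
  ultimately show ?thesis
    using assms B_sym[of \<beta>]
    by (simp add: refl_map_def hyp_form_def emb_def prod_eq_iff B_simps B_radical blinfun.bilinear_simps)
qed

lemma refl_map_hyp_space:
  assumes "\<beta> \<in> D" "\<beta> \<noteq> 0" "\<tau> \<in> V0" "u \<in> hyp_space U"
  shows "refl_map B U (\<beta> + \<tau>) u \<in> hyp_space U"
  unfolding refl_map_apply[OF assms] using assms(4) by (auto simp: hyp_space_def)

lemma refl_map_involution:
  assumes "\<beta> \<in> D" "\<beta> \<noteq> 0" "\<tau> \<in> V0" "u \<in> hyp_space U"
  shows "refl_map B U (\<beta> + \<tau>) (refl_map B U (\<beta> + \<tau>) u) = u"
proof -
  have "blinfun_apply (snd u) \<beta> = 0"
    using assms D_subset_U by (auto simp: hyp_space_def)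
  then show ?thesis
    using assms root_norm[of \<beta>]
    unfolding refl_map_apply[OF assms(1,2,3) refl_map_hyp_space[OF assms]]
    unfolding refl_map_apply[OF assms]
    by (simp add: prod_eq_iff B_simps B_radical algebra_simps)
qed

lemma refl_map_in_GL:
  assumes "\<beta> \<in> D" "\<beta> \<noteq> 0" "\<tau> \<in> V0"
  shows "refl_map B U (\<beta> + \<tau>) \<in> carrier (hyp_GL U)"
proof -
  have lin: "r *\<^sub>R x + q *\<^sub>R y \<in> hyp_space U" if "x \<in> hyp_space U" "y \<in> hyp_space U" for r q x y
    using subspace_hyp_space[of U] that by (simp add: subspace_add subspace_scale)
  have "bij_betw (refl_map B U (\<beta> + \<tau>)) (hyp_space U) (hyp_space U)"
    using refl_map_involution[OF assms] refl_map_hyp_space[OF assms]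
    by (intro bij_betw_byWitness[of _ "refl_map B U (\<beta> + \<tau>)"]) auto
  then have "refl_map B U (\<beta> + \<tau>) \<in> Bij (hyp_space U)"
    by (simp add: Bij_def refl_map_def)
  then show ?thesis
    unfolding GL_carrier_iff using lin
    by (auto simp: refl_map_apply[OF assms] B_simps blinfun.bilinear_simps algebra_simps)
qed

lemma T_map_in_GL:
  assumes "\<beta> \<in> D" "\<sigma> \<in> V0"
  shows "T_map B U \<beta> \<sigma> \<in> carrier (hyp_GL U)"
  by (rule root_int_coords[OF assms(1)]) (use assms in \<open>auto simp: T_map_heis subspace_scale subspace_radical intro!: heis_in_GL\<close>)

text \<open>
  Both sides send \<open>(v, f)\<close> to the pair with first component
  \<open>v + (f \<tau> - f \<rho>) \<beta> - (b + f \<tau>) \<tau> + (b + 2 f \<tau> - f \<rho>) \<rho>\<close>, where \<open>b = B \<beta> v\<close>.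
\<close>

lemma refl_map_product:
  assumes \<beta>: "\<beta> \<in> D" "\<beta> \<noteq> 0" and "\<tau> \<in> V0" "\<rho> \<in> V0"
  shows "refl_map B U (\<beta> + \<rho>) \<otimes>\<^bsub>hyp_GL U\<^esub> refl_map B U (\<beta> + \<tau>) =
    T_map B U \<beta> \<rho> \<otimes>\<^bsub>hyp_GL U\<^esub> T_map B U \<beta> (- \<tau>)"
proof -
  have U: "\<beta> \<in> U" using \<beta> D_subset_U by auto
  have \<tau>: "- \<tau> \<in> V0" by (simp add: assms subspace_neg subspace_radical)
  have eq: "T_map B U \<beta> \<sigma> u = (fst u - blinfun_apply (snd u) \<sigma> *\<^sub>R \<beta> + B \<beta> (fst u) *\<^sub>R \<sigma>
      - blinfun_apply (snd u) \<sigma> *\<^sub>R \<sigma>, snd u)" if "u \<in> hyp_space U" "\<sigma> \<in> V0" for u \<sigma>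
    using that root_norm[OF \<beta>] by (simp add: T_map_unip[OF U] unip_def)
  have mem: "T_map B U \<beta> \<sigma> u \<in> hyp_space U" if "u \<in> hyp_space U" "\<sigma> \<in> V0" for u \<sigma>
    using that eq by (auto simp: hyp_space_def)
  have "compose (hyp_space U) (refl_map B U (\<beta> + \<rho>)) (refl_map B U (\<beta> + \<tau>)) =
    compose (hyp_space U) (T_map B U \<beta> \<rho>) (T_map B U \<beta> (- \<tau>))"
    unfolding compose_def
  proof (rule restrict_ext)
    fix u assume u: "u \<in> hyp_space U"
    have two: "(2 * r) *\<^sub>R x = r *\<^sub>R x + r *\<^sub>R x" for r and x :: 'v
      by (metis mult_2 scaleR_left_distrib)
    have "blinfun_apply (snd u) \<beta> = 0" using u U by (auto simp: hyp_space_def)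
    then show "refl_map B U (\<beta> + \<rho>) (refl_map B U (\<beta> + \<tau>) u) = T_map B U \<beta> \<rho> (T_map B U \<beta> (- \<tau>) u)"
      using root_norm[OF \<beta>] assms u
      unfolding refl_map_apply[OF \<beta> assms(4) refl_map_hyp_space[OF \<beta> assms(3) u]] eq[OF mem[OF u \<tau>] assms(4)]
      unfolding refl_map_apply[OF \<beta> assms(3) u] eq[OF u \<tau>]
      by (simp add: prod_eq_iff B_simps B_radical blinfun.bilinear_simps algebra_simps two)
  qed
  then show ?thesis
    using refl_map_in_GL[OF \<beta>] T_map_in_GL[OF \<beta>(1)] assms \<tau> by (simp add: GL_mult)
qed

text \<open>
  A product of two reflections in roots that differ by a radical vector involves a single finite root
  \<open>\<beta>\<close>, because \<open>U\<close> meets the radical trivially. Taking \<open>\<tau> = 0\<close> shows that each \<open>T_map B U \<beta> \<sigma>\<close> itself is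
  such a product.
\<close>

lemma heisenberg_carrier:
  "carrier H = generate (hyp_GL U) {T_map B U \<beta> \<sigma> | \<beta> \<sigma>. \<beta> \<in> D \<and> \<beta> \<noteq> 0 \<and> \<sigma> \<in> S}"
  (is "_ = generate ?G ?T")
proof -
  interpret G: group ?G by (rule group_hyp_GL)
  let ?W = "{refl_map B U (\<alpha> + \<sigma>) \<otimes>\<^bsub>?G\<^esub> refl_map B U \<alpha> | \<alpha> \<sigma>.
        \<alpha> \<in> nonisotropic B R \<and> \<sigma> \<in> V0 \<and> \<alpha> + \<sigma> \<in> R}"
  have T: "?T \<subseteq> carrier ?G" using T_map_in_GL S_radical by auto
  have WT: "?W \<subseteq> generate ?G ?T"
  proof
    fix w assume "w \<in> ?W"
    then obtain \<alpha> \<sigma> where w: "w = refl_map B U (\<alpha> + \<sigma>) \<otimes>\<^bsub>?G\<^esub> refl_map B U \<alpha>"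
      and \<alpha>: "\<alpha> \<in> nonisotropic B R" and \<sigma>: "\<sigma> \<in> V0" and "\<alpha> + \<sigma> \<in> R" by blast
    then have "\<alpha> + \<sigma> \<in> nonisotropic B R" by (simp add: nonisotropic_def B_simps B_radical)
    then obtain \<beta> \<tau> \<beta>' \<rho> where
      1: "\<beta> \<in> D" "\<beta> \<noteq> 0" "\<tau> \<in> S" "\<alpha> = \<beta> + \<tau>" and
      2: "\<beta>' \<in> D" "\<rho> \<in> S" "\<alpha> + \<sigma> = \<beta>' + \<rho>"
      using \<alpha> unfolding nonisotropic_iff by blast
    have "\<beta> - \<beta>' = \<rho> - \<sigma> - \<tau>" using 1(4) 2(3) by (simp add: algebra_simps)
    moreover have "\<rho> - \<sigma> - \<tau> \<in> V0" 
      using 1 2 \<sigma> by (simp add: subspace_diff subspace_radical S_radical)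
    moreover have "\<beta> - \<beta>' \<in> U" using 1 2 D_subset_U by (auto intro: subspace_diff subspace_U)
    ultimately have "\<beta> - \<beta>' = 0" by (intro U_radical) simp_all
    then have eq: "\<alpha> + \<sigma> = \<beta> + \<rho>" using 2 by simp
    have w_eq: "w = T_map B U \<beta> \<rho> \<otimes>\<^bsub>?G\<^esub> T_map B U \<beta> (- \<tau>)"
      unfolding w eq unfolding 1(4) using 1 2 by (intro refl_map_product S_radical)
    have "T_map B U \<beta> \<rho> \<in> ?T" "T_map B U \<beta> (- \<tau>) \<in> ?T"
      using 1 2 S_neg by blast+
    then show "w \<in> generate ?G ?T"
      unfolding w_eq by (intro generate.eng generate.incl)
  qed
  have "?T \<subseteq> ?W"
  proof
    fix t assume "t \<in> ?T"
    then obtain \<beta> \<sigma> where t: "t = T_map B U \<beta> \<sigma>" and \<beta>: "\<beta> \<in> D" "\<beta> \<noteq> 0" and \<sigma>: "\<sigma> \<in> S" by blast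
    have "T_map B U \<beta> 0 = \<one>\<^bsub>?G\<^esub>"
      using \<beta> D_subset_U by (subst T_map_unip) (auto simp: subspace_0 subspace_radical unip_def GL_one intro!: restrict_ext)
    then have "t = refl_map B U (\<beta> + \<sigma>) \<otimes>\<^bsub>?G\<^esub> refl_map B U \<beta>"
      using refl_map_product[OF \<beta>, of 0 \<sigma>] T_map_in_GL[OF \<beta>(1)] \<sigma>
      by (simp add: subspace_0 subspace_radical S_radical t)
    moreover have "\<beta> \<in> nonisotropic B R" "\<beta> + \<sigma> \<in> nonisotropic B R"
      unfolding nonisotropic_iff using \<beta> \<sigma> S_zero by (metis add.right_neutral)+
    ultimately show "t \<in> ?W" using \<sigma> S_radical by (auto simp: nonisotropic_def)
  qed
  then have "generate ?G ?T \<subseteq> generate ?G ?W" by (rule G.mono_generate)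
  moreover have "generate ?G ?W \<subseteq> generate ?G ?T"
    by (rule G.generate_subgroup_incl[OF WT G.generate_is_subgroup[OF T]])
  ultimately show ?thesis by (simp add: heisenberg_group_def)
qed

lemma H_subgroup: "subgroup (carrier H) (hyp_GL U)"
  unfolding heisenberg_carrier
  by (rule group.generate_is_subgroup[OF group_hyp_GL]) (use T_map_in_GL S_radical in auto)

lemma H_mult: "g \<otimes>\<^bsub>H\<^esub> h = g \<otimes>\<^bsub>hyp_GL U\<^esub> h"
  by (simp add: heisenberg_group_def)

lemma T_map_in_H: "\<beta> \<in> D \<Longrightarrow> \<beta> \<noteq> 0 \<Longrightarrow> \<sigma> \<in> S \<Longrightarrow> T_map B U \<beta> \<sigma> \<in> carrier H"
  unfolding heisenberg_carrier by (auto intro: generate.incl)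

lemma T_map_inv:
  assumes "\<beta> \<in> D" "\<sigma> \<in> V0"
  shows "inv\<^bsub>hyp_GL U\<^esub> (T_map B U \<beta> \<sigma>) = T_map B U \<beta> (- \<sigma>)"
proof (rule group.inv_equality[OF group_hyp_GL])
  have neg: "- \<sigma> \<in> V0" using assms by (simp add: subspace_neg subspace_radical)
  obtain k where k: "\<beta> = (\<Sum>i\<in>{1..l}. of_int (k i) *\<^sub>R a i)" by (rule root_int_coords[OF assms(1)])
  have "cocycle (\<lambda>i. of_int (k i) *\<^sub>R (- \<sigma>)) (\<lambda>i. of_int (k i) *\<^sub>R \<sigma>) = 0"
    unfolding cocycle_scaled using wedge_scale_left[of "-1" \<sigma> \<sigma>] by simp
  then have "T_map B U \<beta> (- \<sigma>) \<otimes>\<^bsub>hyp_GL U\<^esub> T_map B U \<beta> \<sigma> =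
      heis (\<lambda>i. of_int (k i) *\<^sub>R (- \<sigma>) + of_int (k i) *\<^sub>R \<sigma>) (0 + 0 + 0)"
    unfolding T_map_heis[OF k assms(2)] T_map_heis[OF k neg] using assms neg
    by (subst heis_mult)
      (simp_all add: subspace_scale subspace_0 subspace_radical del: scaleR_minus_right)
  also have "\<dots> = \<one>\<^bsub>hyp_GL U\<^esub>"
    by (subst heis_zero) (auto simp: shear_zero)
  finally show "T_map B U \<beta> (- \<sigma>) \<otimes>\<^bsub>hyp_GL U\<^esub> T_map B U \<beta> \<sigma> = \<one>\<^bsub>hyp_GL U\<^esub>" .
qed (use assms in \<open>auto intro!: T_map_in_GL subspace_neg subspace_radical\<close>)

text \<open>
  A property of coordinates \<open>(x, E)\<close> that holds for the generators and is preserved by the product law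
  is attained on all of \<open>H\<close>. Inverses need no separate clause, because the set of generators is closed under them.
  The property is only claimed for some coordinates of \<open>h\<close>: the parameter \<open>E\<close> is
  determined on functionals vanishing on \<open>U\<close> only.
\<close>

lemma H_heis_induct:
  assumes "h \<in> carrier H"
    and gen: "\<And>k \<sigma>. (\<Sum>i\<in>{1..l}. of_int (k i) *\<^sub>R a i) \<in> D \<Longrightarrow>
      (\<Sum>i\<in>{1..l}. of_int (k i) *\<^sub>R a i) \<noteq> 0 \<Longrightarrow> \<sigma> \<in> S \<Longrightarrow> \<Phi> (\<lambda>i. of_int (k i :: int) *\<^sub>R \<sigma>) 0"
    and one: "\<Phi> (\<lambda>_. 0) 0"
    and mult: "\<And>x E y F. \<Phi> x E \<Longrightarrow> \<Phi> y F \<Longrightarrow> \<Phi> (\<lambda>i. x i + y i) (E + F + cocycle x y)"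
    and rad: "\<And>x E. \<Phi> x E \<Longrightarrow> radical_valued x E"
  shows "\<exists>x E. \<Phi> x E \<and> h = heis x E"
proof -
  have T: "\<exists>x E. \<Phi> x E \<and> T_map B U \<beta> \<sigma> = heis x E" if \<beta>: "\<beta> \<in> D" "\<beta> \<noteq> 0" and \<sigma>: "\<sigma> \<in> S" for \<beta> \<sigma>
  proof -
    obtain k where k: "\<beta> = (\<Sum>i\<in>{1..l}. of_int (k i) *\<^sub>R a i)" by (rule root_int_coords[OF \<beta>(1)])
    show ?thesis
      using gen[of k \<sigma>] \<beta> \<sigma> T_map_heis[OF k S_radical[OF \<sigma>]] k by blast
  qed
  from assms(1) show ?thesis
    unfolding heisenberg_carrier
  proof induction
    case one
    have "heis (\<lambda>_. 0) 0 = \<one>\<^bsub>hyp_GL U\<^esub>" by (simp add: heis_zero shear_zero)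
    then show ?case using assms(3) by metis
  next
    case (incl h)
    then show ?case using T by auto
  next
    case (inv h)
    then show ?case using T S_neg S_radical by (auto simp: T_map_inv)
  next
    case (eng g h)
    then obtain x E y F where *: "\<Phi> x E" "g = heis x E" "\<Phi> y F" "h = heis y F" by blast
    have "g \<otimes>\<^bsub>hyp_GL U\<^esub> h = heis (\<lambda>i. x i + y i) (E + F + cocycle x y)"
      unfolding * using rad[OF *(1)] rad[OF *(3)] by (intro heis_mult) (auto simp: radical_valued_def)
    then show ?case using mult[OF *(1,3)] by blast
  qed
qed


section \<open>The center consists of shears\<close>

text \<open>
  Antisymmetrizing the cocycle replaces \<open>h\<close> by the Gram matrix of the simple roots.
\<close>

lemma cocycle_commutator:
  "cocycle x y - cocycle y x = (\<Sum>i\<in>{1..l}. wedge (\<Sum>j\<in>{1..l}. B (a i) (a j) *\<^sub>R x j) (y i))"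
proof -
  have "cocycle y x = (\<Sum>i\<in>{1..l}. \<Sum>j\<in>{1..l}. half j i *\<^sub>R wedge (y i) (x j))"
    unfolding cocycle_def by (rule sum.swap)
  also have "\<dots> = - (\<Sum>i\<in>{1..l}. \<Sum>j\<in>{1..l}. half j i *\<^sub>R wedge (x j) (y i))"
    by (subst wedge_swap) (simp add: sum_negf)
  finally have "cocycle x y - cocycle y x =
      (\<Sum>i\<in>{1..l}. \<Sum>j\<in>{1..l}. (half i j + half j i) *\<^sub>R wedge (x j) (y i))"
    by (simp add: cocycle_def sum.distrib scaleR_left_distrib)
  also have "\<dots> = (\<Sum>i\<in>{1..l}. \<Sum>j\<in>{1..l}. B (a i) (a j) *\<^sub>R wedge (x j) (y i))"
    by (intro sum.cong refl) (simp add: half_add_swap)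
  finally show ?thesis by (simp add: wedge_sum_left wedge_scale_left)
qed

lemma heis_eqD:
  assumes "heis x E = heis x F" "\<forall>u\<in>U. blinfun_apply f u = 0"
  shows "blinfun_apply E f = blinfun_apply F f"
proof -
  have "(0, f) \<in> hyp_space U" using assms(2) by (simp add: hyp_space_def)
  with fun_cong[OF assms(1), of "(0, f)"] show ?thesis
    by (simp add: heis_def unip_def)
qed

text \<open>
  Such an \<open>f\<close> is available as a second component of the hyperbolic space and can thus be used to test
  elements of \<open>H\<close>.
\<close>

lemma separating_functional:
  assumes "w \<notin> U"
  obtains f :: "'v \<Rightarrow>\<^sub>L real" where "\<forall>u\<in>U. blinfun_apply f u = 0" "blinfun_apply f w = 1"
proof -
  obtain C where C: "C \<subseteq> U" "independent C" "U \<subseteq> span C"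
    by (rule maximal_independent_subset)
  have "w \<notin> span C"
    using assms C(1) span_minimal[OF C(1) subspace_U] by auto
  then have ind: "independent (insert w C)" and "w \<notin> C"
    using C(2) by (auto simp: independent_insert intro: span_base)
  obtain g :: "'v \<Rightarrow> real" where g: "linear g" "\<forall>x\<in>insert w C. g x = (if x = w then 1 else 0)"
    using linear_independent_extend[OF ind, of "\<lambda>x. if x = w then 1 else 0"] by (elim exE conjE)
  have "g u = 0" if "u \<in> U" for u
  proof (rule linear_eq_0_on_span[OF g(1)])
    show "g x = 0" if "x \<in> C" for x using g(2) that \<open>w \<notin> C\<close> by auto
    show "u \<in> span C" using C(3) that by auto
  qed
  moreover have "bounded_linear g" using g(1) linear_conv_bounded_linear by blast
  ultimately show ?thesis
    using that[of "Blinfun g"] g(2) by (simp add: bounded_linear_Blinfun_apply)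
qed

text \<open>
  Nondegeneracy of the form on \<open>U\<close>, applied to one real coordinate of the tuple \<open>x\<close> at a time.
\<close>

lemma coords_zeroI:
  fixes x :: "nat \<Rightarrow> 'v"
  assumes "\<And>k. k \<in> {1..l} \<Longrightarrow> (\<Sum>j\<in>{1..l}. B (a k) (a j) *\<^sub>R x j) = 0" "i \<in> {1..l}"
  shows "x i = 0"
proof -
  \<comment> \<open>Testing against \<open>x i\<close> itself suffices, as \<open>c i\<close> is then the squared length of \<open>x i\<close>.\<close>
  define c where "c j = x i \<bullet> x j" for j
  define u where "u = (\<Sum>j\<in>{1..l}. c j *\<^sub>R a j)"
  have "B (a k) u = 0" if "k \<in> {1..l}" for k
  proof -
    have "B (a k) u = x i \<bullet> (\<Sum>j\<in>{1..l}. B (a k) (a j) *\<^sub>R x j)"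
      by (simp add: u_def c_def B_sum_right B_simps inner_sum_right mult.commute)
    then show ?thesis using assms(1)[OF that] by simp
  qed
  then have "B u u = 0"
    by (subst u_def) (simp add: B_sum_left B_simps)
  moreover have "u \<in> U"
    unfolding u_def by (intro subspace_sum subspace_scale subspace_U simple_in_U)
  ultimately have "u = 0" using B_pos by fastforce
  then have "c i = 0" using simple_independent[of c i] assms(2) by (simp add: u_def)
  then show ?thesis by (simp add: c_def)
qed

end

context heisenberg_setup
begin

text \<open>
  If \<open>w\<close> were nonzero, evaluating the wedges at an \<open>f\<close> with \<open>f w = 1\<close> would make every \<open>\<sigma>\<close> in \<open>S\<close> a multiple
  of \<open>w\<close>, so that the radical would be a line.
\<close>

lemma wedge_eq_zeroD:
  assumes w: "w \<in> V0" and dim: "dim V0 \<noteq> 1"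
    and wedge: "\<And>\<sigma> f. \<sigma> \<in> S \<Longrightarrow> \<forall>u\<in>U. blinfun_apply f u = 0 \<Longrightarrow> blinfun_apply (wedge w \<sigma>) f = 0"
  shows "w = 0"
proof (rule ccontr)
  assume "w \<noteq> 0"
  then have "w \<notin> U" using w U_radical by auto
  then obtain f :: "'v \<Rightarrow>\<^sub>L real" where f: "\<forall>u\<in>U. blinfun_apply f u = 0" "blinfun_apply f w = 1"
    by (rule separating_functional)
  have "\<sigma> \<in> span {w}" if "\<sigma> \<in> S" for \<sigma>
  proof -
    have "\<sigma> = blinfun_apply f \<sigma> *\<^sub>R w" using wedge[OF that f(1)] f(2) by simp
    then show ?thesis by (metis span_base span_scale singletonI)
  qed
  then have "V0 \<subseteq> span {w}" using S_span span_minimal[of S "span {w}"] by auto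
  moreover have "span {w} \<subseteq> V0" using w by (intro span_minimal subspace_radical) auto
  ultimately have "V0 = span {w}" by auto
  then have "dim V0 = 1" using \<open>w \<noteq> 0\<close> by (simp add: dim_eq_card_independent)
  with dim show False by simp
qed

text \<open>
  Commuting with \<open>T_map B U (a k) \<sigma>\<close> makes the antisymmetrized cocycle vanish, which for this choice of the second
  argument is a single wedge with \<open>\<sigma>\<close>.
\<close>

lemma center_coords_zero:
  assumes h: "h \<in> group_center H" "h = heis x E" and rad: "radical_valued x E"
    and dim: "dim V0 \<noteq> 1" and i: "i \<in> {1..l}"
  shows "x i = 0"
proof (rule coords_zeroI[OF _ i])
  fix k assume k: "k \<in> {1..l}"
  have x: "\<forall>i\<in>{1..l}. x i \<in> V0" and E: "\<And>f. blinfun_apply E f \<in> V0"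
    using rad by (auto simp: radical_valued_def)
  show "(\<Sum>j\<in>{1..l}. B (a k) (a j) *\<^sub>R x j) = 0"
  proof (rule wedge_eq_zeroD[OF _ dim])
    show "(\<Sum>j\<in>{1..l}. B (a k) (a j) *\<^sub>R x j) \<in> V0"
      using x by (intro subspace_sum subspace_scale subspace_radical) auto
    fix \<sigma> and f :: "'v \<Rightarrow>\<^sub>L real"
    assume \<sigma>: "\<sigma> \<in> S" and f: "\<forall>u\<in>U. blinfun_apply f u = 0"
    \<comment> \<open>The coordinates of the simple root \<open>a k\<close>.\<close>
    define p :: "nat \<Rightarrow> int" where "p i = (if i = k then 1 else 0)" for i
    define y where "y = (\<lambda>i. of_int (p i) *\<^sub>R \<sigma>)"
    have "a k = (\<Sum>i\<in>{1..l}. of_int (p i) *\<^sub>R a i)"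
      using k by (simp add: p_def if_distrib[of of_int] if_distrib[of "\<lambda>r. r *\<^sub>R _"] cong: if_cong)
    then have T: "T_map B U (a k) \<sigma> = heis y 0"
      unfolding y_def by (rule T_map_heis) (rule S_radical[OF \<sigma>])
    have y: "\<forall>i\<in>{1..l}. y i \<in> V0"
      using S_radical[OF \<sigma>] by (auto simp: y_def subspace_scale subspace_radical)
    have "T_map B U (a k) \<sigma> \<in> carrier H"
      using k by (intro T_map_in_H simple_in_D simple_nonzero \<sigma>)
    then have "heis x E \<otimes>\<^bsub>hyp_GL U\<^esub> heis y 0 = heis y 0 \<otimes>\<^bsub>hyp_GL U\<^esub> heis x E"
      using h T by (simp add: group_center_def H_mult)
    then have "heis (\<lambda>i. x i + y i) (E + 0 + cocycle x y) = heis (\<lambda>i. x i + y i) (0 + E + cocycle y x)"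
      using heis_mult[OF x y, of 0 E] heis_mult[OF y x E, of 0]
      by (simp add: add.commute subspace_0 subspace_radical)
    from heis_eqD[OF this f] have "blinfun_apply (cocycle x y - cocycle y x) f = 0"
      by (simp add: blinfun.bilinear_simps)
    moreover have "cocycle x y - cocycle y x = wedge (\<Sum>j\<in>{1..l}. B (a k) (a j) *\<^sub>R x j) \<sigma>"
      using k unfolding cocycle_commutator
      by (simp add: y_def p_def if_distrib[of of_int] if_distrib[of "\<lambda>r. r *\<^sub>R _"] if_distrib[of "wedge _"]
          cong: if_cong)
    ultimately show "blinfun_apply (wedge (\<Sum>j\<in>{1..l}. B (a k) (a j) *\<^sub>R x j) \<sigma>) f = 0" by simp
  qed
qed

lemma shear_central:
  assumes "shear U E \<in> carrier H" and E: "\<And>f. blinfun_apply E f \<in> V0"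
  shows "shear U E \<in> group_center H"
proof -
  have "shear U E \<otimes>\<^bsub>H\<^esub> g = g \<otimes>\<^bsub>H\<^esub> shear U E" if "g \<in> carrier H" for g
  proof -
    have "\<exists>x F. radical_valued x F \<and> g = heis x F"
      using that by (rule H_heis_induct[where \<Phi> = radical_valued])
        (simp_all add: radical_valued_def blinfun.bilinear_simps subspace_scale subspace_add subspace_0
          subspace_radical S_radical cocycle_radical)
    then obtain x F where x: "\<forall>i\<in>{1..l}. x i \<in> V0" and F: "\<And>f. blinfun_apply F f \<in> V0"
      and g: "g = heis x F" by (auto simp: radical_valued_def)
    have s: "shear U E = heis (\<lambda>_. 0) E" by (simp add: heis_zero)
    have z: "\<forall>i\<in>{1..l}. (0::'v) \<in> V0" by (simp add: subspace_0 subspace_radical)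
    show ?thesis
      unfolding s g H_mult heis_mult[OF x z E] heis_mult[OF z x F]
      by (simp add: cocycle_def add.commute)
  qed
  then show ?thesis using assms(1) by (simp add: group_center_def)
qed

text \<open>
  Reduces the computation of the center to finding a set \<open>L\<close> of parameters of shears in \<open>H\<close> that contains the
  parameter of each element of \<open>H\<close> having vanishing tuple.
\<close>

lemma center_eq_shear_image:
  assumes dim: "dim V0 \<noteq> 1"
    and coords: "\<And>h. h \<in> carrier H \<Longrightarrow> \<exists>x E. radical_valued x E \<and>
      ((\<forall>i\<in>{1..l}. x i = 0) \<longrightarrow> E \<in> L) \<and> h = heis x E"
    and L: "\<And>E. E \<in> L \<Longrightarrow> shear U E \<in> carrier H" "\<And>E f. E \<in> L \<Longrightarrow> blinfun_apply E f \<in> V0"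
  shows "group_center H = shear U ` L"
proof
  show "group_center H \<subseteq> shear U ` L"
  proof
    fix h assume h: "h \<in> group_center H"
    then have "h \<in> carrier H" by (simp add: group_center_def)
    then obtain x E where *: "radical_valued x E" "(\<forall>i\<in>{1..l}. x i = 0) \<longrightarrow> E \<in> L" "h = heis x E"
      using coords by blast
    then have "\<forall>i\<in>{1..l}. x i = 0" using center_coords_zero[OF h] dim by auto
    with * heis_zero show "h \<in> shear U ` L" by auto
  qed
  show "shear U ` L \<subseteq> group_center H" using L shear_central by auto
qed

text \<open>
  This is the commutator of \<open>T_map B U \<beta> \<sigma>\<close> and \<open>T_map B U \<gamma> \<tau>\<close>: the sum of the two \<open>half\<close>-values is
  \<open>B \<beta> \<gamma>\<close>.
\<close>

lemma commutator_in_H: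
  assumes \<beta>: "\<beta> \<in> D" "\<beta> \<noteq> 0" and \<gamma>: "\<gamma> \<in> D" "\<gamma> \<noteq> 0" and \<sigma>: "\<sigma> \<in> S" and \<tau>: "\<tau> \<in> S"
  shows "shear U (B \<beta> \<gamma> *\<^sub>R wedge \<sigma> \<tau>) \<in> carrier H"
proof -
  interpret G: group "hyp_GL U" by (rule group_hyp_GL)
  obtain k where k: "\<beta> = (\<Sum>i\<in>{1..l}. of_int (k i) *\<^sub>R a i)" by (rule root_int_coords[OF \<beta>(1)])
  obtain m where m: "\<gamma> = (\<Sum>i\<in>{1..l}. of_int (m i) *\<^sub>R a i)" by (rule root_int_coords[OF \<gamma>(1)])
  define x y where "x = (\<lambda>i. of_int (k i) *\<^sub>R \<sigma>)" and "y = (\<lambda>i. of_int (m i) *\<^sub>R \<tau>)"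
  let ?g = "T_map B U \<beta> \<sigma>" and ?h = "T_map B U \<gamma> \<tau>"
  have g: "?g = heis x 0" and h: "?h = heis y 0"
    unfolding x_def y_def using T_map_heis[OF k] T_map_heis[OF m] \<sigma> \<tau> S_radical by auto
  have rad: "\<forall>i\<in>{1..l}. x i \<in> V0" "\<forall>i\<in>{1..l}. y i \<in> V0" "\<forall>i\<in>{1..l}. y i + x i \<in> V0"
    "\<forall>i\<in>{1..l}. (0::'v) \<in> V0" "blinfun_apply 0 f \<in> V0" for f :: "'v \<Rightarrow>\<^sub>L real"
    using \<sigma> \<tau> by (auto simp: x_def y_def subspace_scale subspace_add subspace_0 subspace_radical S_radical)
  let ?C = "B \<beta> \<gamma> *\<^sub>R wedge \<sigma> \<tau>"
  have C: "cocycle x y = cocycle y x + ?C"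
  proof -
    have "cocycle y x = - ((\<Sum>i\<in>{1..l}. \<Sum>j\<in>{1..l}. half i j * of_int (m j) * of_int (k i)) *\<^sub>R wedge \<sigma> \<tau>)"
      unfolding x_def y_def cocycle_scaled by (subst wedge_swap) simp
    moreover have "cocycle x y = (\<Sum>i\<in>{1..l}. \<Sum>j\<in>{1..l}. half i j * of_int (k j) * of_int (m i)) *\<^sub>R wedge \<sigma> \<tau>"
      unfolding x_def y_def cocycle_scaled by simp
    ultimately show ?thesis
      unfolding k m half_bilinear_add_swap[symmetric] by (simp add: scaleR_left_distrib)
  qed
  have Crad: "blinfun_apply ?C f \<in> V0" for f
    unfolding scaleR_blinfun.rep_eq
    by (intro subspace_scale subspace_radical wedge_radical S_radical \<sigma> \<tau>)
  have "(?h \<otimes>\<^bsub>hyp_GL U\<^esub> ?g) \<otimes>\<^bsub>hyp_GL U\<^esub> shear U ?C =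
      heis (\<lambda>i. y i + x i) (0 + 0 + cocycle y x) \<otimes>\<^bsub>hyp_GL U\<^esub> heis (\<lambda>_. 0) ?C"
    unfolding g h using rad by (subst heis_mult) (auto simp: heis_zero)
  also have "\<dots> = heis (\<lambda>i. y i + x i + 0) (0 + 0 + cocycle y x + ?C + cocycle (\<lambda>i. y i + x i) (\<lambda>_. 0))"
    by (rule heis_mult[OF rad(3,4) Crad])
  also have "\<dots> = heis (\<lambda>i. x i + y i) (0 + 0 + cocycle x y)"
    unfolding C by (simp add: cocycle_def add.commute)
  also have "\<dots> = ?g \<otimes>\<^bsub>hyp_GL U\<^esub> ?h"
    unfolding g h using rad by (subst heis_mult) auto
  finally have eq: "(?h \<otimes>\<^bsub>hyp_GL U\<^esub> ?g) \<otimes>\<^bsub>hyp_GL U\<^esub> shear U ?C = ?g \<otimes>\<^bsub>hyp_GL U\<^esub> ?h" .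
  have gH: "?g \<in> carrier H" and hH: "?h \<in> carrier H"
    using assms by (auto intro: T_map_in_H)
  have gG: "?g \<in> carrier (hyp_GL U)" "?h \<in> carrier (hyp_GL U)"
    using gH hH subgroup.subset[OF H_subgroup] by auto
  then have "shear U ?C = inv\<^bsub>hyp_GL U\<^esub> (?h \<otimes>\<^bsub>hyp_GL U\<^esub> ?g) \<otimes>\<^bsub>hyp_GL U\<^esub> (?g \<otimes>\<^bsub>hyp_GL U\<^esub> ?h)"
    using G.inv_solve_left[of "shear U ?C" "?h \<otimes>\<^bsub>hyp_GL U\<^esub> ?g" "?g \<otimes>\<^bsub>hyp_GL U\<^esub> ?h"] eq
    by (simp add: shear_in_GL)
  then show ?thesis
    using gH hH H_subgroup by (simp add: subgroup.m_closed subgroup.m_inv_closed)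
qed

end

section \<open>Centers in terms of an integral basis\<close>

locale based_setup = heisenberg_setup B U R l a S
  for B :: "'v::euclidean_space \<Rightarrow> 'v \<Rightarrow> real" and U R :: "'v set" and l a and S :: "'v set" +
  fixes \<nu> :: nat and s :: "nat \<Rightarrow> 'v"
  assumes basis: "int_basis S \<nu> s"
    and nullity_not_1: "dim (form_radical B) \<noteq> 1"
begin

definition wedges :: "(('v \<Rightarrow>\<^sub>L real) \<Rightarrow>\<^sub>L 'v) set" where
  "wedges = {wedge (s r) (s t) | r t. 1 \<le> r \<and> r < t \<and> t \<le> \<nu>}"

lemma s_in_S: "r \<in> {1..\<nu>} \<Longrightarrow> s r \<in> S"
  and s_inj: "inj_on s {1..\<nu>}"
  and s_independent: "int_module.independent (s ` {1..\<nu>})"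
  and s_span: "int_module.span (s ` {1..\<nu>}) = \<Lambda>"
  using basis by (auto simp: int_basis_def)

lemma s_radical: "r \<in> {1..\<nu>} \<Longrightarrow> s r \<in> V0"
  by (intro S_radical s_in_S)

lemma s_coeff_zero:
  fixes n :: "nat \<Rightarrow> int"
  assumes "(\<Sum>r\<in>{1..\<nu>}. of_int (n r) *\<^sub>R s r) = 0" "r \<in> {1..\<nu>}"
  shows "n r = 0"
proof -
  have "(\<Sum>v\<in>s ` {1..\<nu>}. int_scale (n (the_inv_into {1..\<nu>} s v)) v) = (\<Sum>r\<in>{1..\<nu>}. of_int (n r) *\<^sub>R s r)"
    by (subst sum.reindex[OF s_inj]) (simp add: int_scale_def the_inv_into_f_f[OF s_inj] del: One_nat_def)
  then have "n (the_inv_into {1..\<nu>} s (s r)) = 0"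
    using int_module.independentD[OF s_independent, of "s ` {1..\<nu>}"
        "\<lambda>v. n (the_inv_into {1..\<nu>} s v)" "s r"] assms by auto
  then show ?thesis by (simp add: the_inv_into_f_f[OF s_inj assms(2)] del: One_nat_def)
qed

lemma c_elt_shear: "r \<in> {1..\<nu>} \<Longrightarrow> t \<in> {1..\<nu>} \<Longrightarrow> c_elt B U s r t = shear U (wedge (s r) (s t))"
  by (simp add: c_elt_def T_map_radical s_radical)

lemma c_elts_shear: "{c_elt B U s r t | r t. 1 \<le> r \<and> r < t \<and> t \<le> \<nu>} = shear U ` wedges"
proof -
  have "c_elt B U s r t = shear U (wedge (s r) (s t))" if "1 \<le> r \<and> r < t \<and> t \<le> \<nu>" for r t
    using that by (intro c_elt_shear) auto
  then show ?thesis unfolding wedges_def by (auto simp: image_def) metis+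
qed

lemma wedge_in_span_wedges:
  assumes "x \<in> \<Lambda>" "y \<in> \<Lambda>"
  shows "wedge x y \<in> int_module.span wedges"
proof -
  have st: "wedge (s r) (s t) \<in> int_module.span wedges" if "r \<in> {1..\<nu>}" "t \<in> {1..\<nu>}" for r t
  proof (cases r t rule: linorder_cases)
    case less
    then show ?thesis using that by (intro int_module.span_base) (auto simp: wedges_def)
  next
    case equal
    then show ?thesis by (simp add: int_module.span_zero)
  next
    case greater
    then have "wedge (s t) (s r) \<in> int_module.span wedges"
      using that by (intro int_module.span_base) (auto simp: wedges_def)
    then show ?thesis by (subst wedge_swap) (rule int_module.span_neg)
  qed
  have "\<Lambda> \<subseteq> {x. \<forall>t\<in>{1..\<nu>}. wedge x (s t) \<in> int_module.span wedges}"
    unfolding s_span[symmetric]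
    by (rule int_span_subset) (auto simp: st wedge_diff_left int_module.span_zero intro!: int_module.span_diff)
  moreover have "\<Lambda> \<subseteq> {y. wedge x y \<in> int_module.span wedges}"
    if "\<forall>t\<in>{1..\<nu>}. wedge x (s t) \<in> int_module.span wedges" for x
    unfolding s_span[symmetric] using that
    by (intro int_span_subset) (auto simp: wedge_diff_right int_module.span_zero intro!: int_module.span_diff)
  ultimately show ?thesis using assms by blast
qed

lemma span_radical_valued:
  assumes "\<And>E f. E \<in> A \<Longrightarrow> blinfun_apply E f \<in> V0" "E \<in> int_module.span A"
  shows "blinfun_apply E f \<in> V0"
proof -
  have "int_module.span A \<subseteq> {E. \<forall>f. blinfun_apply E f \<in> V0}"
    by (rule int_span_subset)
      (auto simp: assms(1) blinfun.bilinear_simps subspace_0 subspace_diff subspace_radical)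
  then show ?thesis using assms(2) by blast
qed

lemma span_in_H:
  assumes "\<And>E. E \<in> A \<Longrightarrow> shear U E \<in> carrier H" "E \<in> int_module.span A"
  shows "shear U E \<in> carrier H"
proof -
  have "generate (hyp_GL U) (shear U ` A) \<subseteq> carrier H"
    by (rule group.generate_subgroup_incl[OF group_hyp_GL _ H_subgroup]) (use assms(1) in auto)
  then show ?thesis using assms(2) unfolding generate_shear by auto
qed

lemma wedges_radical: "E \<in> wedges \<Longrightarrow> blinfun_apply E f \<in> V0"
  unfolding wedges_def by (auto simp del: wedge_apply intro!: wedge_radical s_radical)

text \<open>
  The cocycle of tuples from the lattice is an integral combination of the wedges of basis vectors, as
  \<open>half\<close> is integral. Hence every element of \<open>H\<close> is some \<open>heis x E\<close> with \<open>E\<close> in their integral span.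
\<close>

theorem center_eq_generate_c:
  assumes c: "\<And>r t. 1 \<le> r \<Longrightarrow> r < t \<Longrightarrow> t \<le> \<nu> \<Longrightarrow> shear U (wedge (s r) (s t)) \<in> carrier H"
  shows "group_center H = generate (hyp_GL U) {c_elt B U s r t | r t. 1 \<le> r \<and> r < t \<and> t \<le> \<nu>}"
  unfolding c_elts_shear generate_shear
proof (rule center_eq_shear_image[OF nullity_not_1])
  define \<Phi> where "\<Phi> = (\<lambda>x E. (\<forall>i\<in>{1..l}. x i \<in> \<Lambda>) \<and> E \<in> int_module.span wedges)"
  have rad: "radical_valued x E" if "\<Phi> x E" for x E
    using that lattice_radical span_radical_valued[OF wedges_radical]
    by (auto simp: \<Phi>_def radical_valued_def)
  have coc: "cocycle x y \<in> int_module.span wedges"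
    if "\<forall>i\<in>{1..l}. x i \<in> \<Lambda>" "\<forall>i\<in>{1..l}. y i \<in> \<Lambda>" for x y
    unfolding cocycle_def
  proof (intro int_module.span_sum)
    fix i j assume ij: "i \<in> {1..l}" "j \<in> {1..l}"
    obtain n :: int where "half i j = of_int n" using half_int[OF ij] by (auto elim: Ints_cases)
    then show "half i j *\<^sub>R wedge (x j) (y i) \<in> int_module.span wedges"
      using ij that by (auto intro!: int_span_of_int_scale wedge_in_span_wedges)
  qed
  fix h assume "h \<in> carrier H"
  then have "\<exists>x E. \<Phi> x E \<and> h = heis x E"
  proof (rule H_heis_induct[where \<Phi> = \<Phi>])
    show "radical_valued x E" if "\<Phi> x E" for x E by (rule rad[OF that])
  qed (auto simp: \<Phi>_def int_module.span_zero int_module.span_base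
      intro!: int_span_of_int_scale int_module.span_add coc)
  then show "\<exists>x E. radical_valued x E \<and>
      ((\<forall>i\<in>{1..l}. x i = 0) \<longrightarrow> E \<in> int_module.span wedges) \<and> h = heis x E"
    using rad by (auto simp: \<Phi>_def)
next
  fix E assume "E \<in> int_module.span wedges"
  then show "shear U E \<in> carrier H"
    by (rule span_in_H[rotated]) (auto simp: wedges_def c)
  fix f show "blinfun_apply E f \<in> V0"
    using \<open>E \<in> int_module.span wedges\<close> wedges_radical by (rule span_radical_valued[rotated])
qed


lemma center_higher_rank:
  assumes "\<beta> \<in> D" "\<beta> \<noteq> 0" "\<gamma> \<in> D" "\<gamma> \<noteq> 0" "B \<beta> \<gamma> = - 1"
  shows "group_center H = generate (hyp_GL U) {c_elt B U s r t | r t. 1 \<le> r \<and> r < t \<and> t \<le> \<nu>}"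
proof (rule center_eq_generate_c)
  fix r t assume "1 \<le> r" "r < t" "t \<le> \<nu>"
  then have "shear U (B \<beta> \<gamma> *\<^sub>R wedge (s t) (s r)) \<in> carrier H"
    using assms by (intro commutator_in_H s_in_S) auto
  then show "shear U (wedge (s r) (s t)) \<in> carrier H"
    using assms(5) wedge_swap[of "s r" "s t"] by simp
qed

section \<open>The center in rank one\<close>

text \<open>
  The parameter of the shear \<open>z_elt B U s J\<close>.
\<close>

definition pair_sum :: "nat set \<Rightarrow> ('v \<Rightarrow>\<^sub>L real) \<Rightarrow>\<^sub>L 'v" where
  "pair_sum J = (\<Sum>r\<in>J. \<Sum>t\<in>J. if r < t then wedge (s r) (s t) else 0)"

text \<open>
  A quadratic map whose polarization agrees modulo 2 with the wedge of two lattice vectors given by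
  their coordinates. On 0-1 vectors it specializes to \<open>pair_sum\<close>.
\<close>

definition pair_form :: "(nat \<Rightarrow> int) \<Rightarrow> ('v \<Rightarrow>\<^sub>L real) \<Rightarrow>\<^sub>L 'v" where
  "pair_form n = (\<Sum>r\<in>{1..\<nu>}. \<Sum>t\<in>{1..\<nu>}. if r < t then of_int (n r * n t) *\<^sub>R wedge (s r) (s t) else 0)"

definition rank_one_gens :: "(('v \<Rightarrow>\<^sub>L real) \<Rightarrow>\<^sub>L 'v) set" where
  "rank_one_gens = {2 *\<^sub>R wedge (s r) (s t) | r t. 1 \<le> r \<and> r < t \<and> t \<le> \<nu>} \<union>
     {pair_sum J | J. J \<in> supp_class \<nu> s ` S}"

lemma foldr_shear: "foldr (mult (hyp_GL U)) (map (shear U) Es) \<one>\<^bsub>hyp_GL U\<^esub> = shear U (sum_list Es)"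
  by (induction Es)
    (simp_all only: foldr.simps list.map sum_list.Nil sum_list.Cons shear_zero shear_mult o_apply id_apply)

lemma z_elt_shear:
  assumes "J \<subseteq> {1..\<nu>}"
  shows "z_elt B U s J = shear U (pair_sum J)"
proof -
  have J: "finite J" using assms finite_subset by blast
  have concat: "sum_list (concat xss) = sum_list (map sum_list xss)" for xss :: "(('v \<Rightarrow>\<^sub>L real) \<Rightarrow>\<^sub>L 'v) list list"
    by (induction xss) auto
  let ?js = "sorted_list_of_set J"
  have "[c_elt B U s r t. r \<leftarrow> ?js, t \<leftarrow> ?js, r < t] =
      map (shear U) [wedge (s r) (s t). r \<leftarrow> ?js, t \<leftarrow> ?js, r < t]"
    using assms J by (auto simp: map_concat c_elt_shear subset_iff intro!: arg_cong[of _ _ concat])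
  moreover have "sum_list [wedge (s r) (s t). r \<leftarrow> ?js, t \<leftarrow> ?js, r < t] = pair_sum J"
  proof -
    have "sum_list [wedge (s r) (s t). r \<leftarrow> ?js, t \<leftarrow> ?js, r < t] =
      (\<Sum>r\<leftarrow>?js. \<Sum>t\<leftarrow>?js. if r < t then wedge (s r) (s t) else 0)"
      by (simp add: concat comp_def if_distrib[of sum_list] cong: if_cong)
    also have "\<dots> = pair_sum J"
      using J by (simp add: pair_sum_def sum_list_distinct_conv_sum_set)
    finally show ?thesis .
  qed
  ultimately show ?thesis unfolding z_elt_def by (simp only: foldr_shear)
qed

lemma c_elt_square:
  assumes "r \<in> {1..\<nu>}" "t \<in> {1..\<nu>}"
  shows "c_elt B U s r t [^]\<^bsub>hyp_GL U\<^esub> (2::nat) = shear U (2 *\<^sub>R wedge (s r) (s t))"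
proof -
  interpret G: group "hyp_GL U" by (rule group_hyp_GL)
  have "c_elt B U s r t [^]\<^bsub>hyp_GL U\<^esub> (2::nat) = shear U (wedge (s r) (s t)) \<otimes>\<^bsub>hyp_GL U\<^esub> shear U (wedge (s r) (s t))"
    unfolding c_elt_shear[OF assms] by (simp add: numeral_2_eq_2 shear_in_GL)
  then show ?thesis by (simp add: shear_mult scaleR_2)
qed

lemma supp_class_subset: "supp_class \<nu> s x \<subseteq> {1..\<nu>}"
  by (auto simp: supp_class_def)

lemma rank_one_gens_shear:
  "{c_elt B U s r t [^]\<^bsub>hyp_GL U\<^esub> (2::nat) | r t. 1 \<le> r \<and> r < t \<and> t \<le> \<nu>} \<union>
     {z_elt B U s J | J. J \<in> supp_class \<nu> s ` S} = shear U ` rank_one_gens"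
proof -
  have "{c_elt B U s r t [^]\<^bsub>hyp_GL U\<^esub> (2::nat) | r t. 1 \<le> r \<and> r < t \<and> t \<le> \<nu>} =
      shear U ` {2 *\<^sub>R wedge (s r) (s t) | r t. 1 \<le> r \<and> r < t \<and> t \<le> \<nu>}" (is "?A = shear U ` ?A'")
  proof -
    have eq: "c_elt B U s r t [^]\<^bsub>hyp_GL U\<^esub> (2::nat) = shear U (2 *\<^sub>R wedge (s r) (s t))"
      if "1 \<le> r \<and> r < t \<and> t \<le> \<nu>" for r t
      using that by (intro c_elt_square) auto
    show ?thesis
    proof (intro equalityI subsetI)
      fix g assume "g \<in> ?A"
      then obtain r t where "1 \<le> r \<and> r < t \<and> t \<le> \<nu>" "g = c_elt B U s r t [^]\<^bsub>hyp_GL U\<^esub> (2::nat)"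
        by blast
      with eq show "g \<in> shear U ` ?A'" by blast
    next
      fix g assume "g \<in> shear U ` ?A'"
      then obtain r t where "1 \<le> r \<and> r < t \<and> t \<le> \<nu>" "g = shear U (2 *\<^sub>R wedge (s r) (s t))"
        by blast
      with eq[symmetric] show "g \<in> ?A" by blast
    qed
  qed
  moreover have "{z_elt B U s J | J. J \<in> supp_class \<nu> s ` S} =
      shear U ` {pair_sum J | J. J \<in> supp_class \<nu> s ` S}" (is "?Z = shear U ` ?Z'")
  proof -
    have eq: "z_elt B U s J = shear U (pair_sum J)" if "J \<in> supp_class \<nu> s ` S" for J
      using that supp_class_subset by (intro z_elt_shear) auto
    show ?thesis
    proof (intro equalityI subsetI)
      fix g assume "g \<in> ?Z"
      then obtain J where "J \<in> supp_class \<nu> s ` S" "g = z_elt B U s J" by blast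
      with eq show "g \<in> shear U ` ?Z'" by blast
    next
      fix g assume "g \<in> shear U ` ?Z'"
      then obtain J where "J \<in> supp_class \<nu> s ` S" "g = shear U (pair_sum J)" by blast
      with eq[symmetric] show "g \<in> ?Z" by blast
    qed
  qed
  ultimately show ?thesis unfolding rank_one_gens_def by (simp only: image_Un)
qed

lemma supp_coords:
  assumes "x \<in> \<Lambda>"
  obtains n :: "nat \<Rightarrow> int" where "x = (\<Sum>r\<in>{1..\<nu>}. of_int (n r) *\<^sub>R s r)"
    "supp_class \<nu> s x = {r \<in> {1..\<nu>}. odd (n r)}"
proof -
  define n where "n r = int_module.representation (s ` {1..\<nu>}) x (s r)" for r
  have "(\<Sum>b\<in>s ` {1..\<nu>}. int_scale (int_module.representation (s ` {1..\<nu>}) x b) b) = x"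
    using assms by (intro int_module.sum_representation_eq) (auto simp: s_independent s_span simp del: One_nat_def)
  then have "x = (\<Sum>r\<in>{1..\<nu>}. of_int (n r) *\<^sub>R s r)"
    by (subst (asm) sum.reindex[OF s_inj]) (simp add: n_def int_scale_def)
  moreover have "supp_class \<nu> s x = {r \<in> {1..\<nu>}. odd (n r)}"
    by (simp add: supp_class_def n_def)
  ultimately show ?thesis by (rule that)
qed

text \<open>
  Reducing the coordinates of a vector of \<open>S\<close> modulo 2 changes it by twice a lattice vector.
\<close>

lemma supp_sum_in_S:
  assumes "J \<in> supp_class \<nu> s ` S"
  shows "(\<Sum>r\<in>J. s r) \<in> S"
proof -
  obtain \<sigma> where \<sigma>: "\<sigma> \<in> S" "J = supp_class \<nu> s \<sigma>" using assms by auto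
  have "\<sigma> \<in> \<Lambda>" using \<sigma>(1) by (rule int_module.span_base)
  then obtain n :: "nat \<Rightarrow> int" where n: "\<sigma> = (\<Sum>r\<in>{1..\<nu>}. of_int (n r) *\<^sub>R s r)"
    "supp_class \<nu> s \<sigma> = {r \<in> {1..\<nu>}. odd (n r)}" by (rule supp_coords)
  have "(\<Sum>r\<in>J. s r) = (\<Sum>r\<in>{1..\<nu>}. of_int (n r mod 2) *\<^sub>R s r)"
    unfolding \<sigma>(2) n(2) by (intro sum.mono_neutral_cong_left) (auto simp: even_iff_mod_2_eq_zero odd_iff_mod_2_eq_one)
  also have "\<dots> = \<sigma> + 2 *\<^sub>R (\<Sum>r\<in>{1..\<nu>}. of_int (- (n r div 2)) *\<^sub>R s r)"
    unfolding n(1) scaleR_sum_right sum.distrib[symmetric]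
  proof (intro sum.cong refl)
    fix r
    have "n r mod 2 = n r + 2 * (- (n r div 2))" by (simp add: minus_mult_div_eq_mod)
    then have "of_int (n r mod 2) = (of_int (n r) + 2 * of_int (- (n r div 2)) :: real)"
      by (metis of_int_add of_int_mult of_int_numeral)
    then show "of_int (n r mod 2) *\<^sub>R s r = of_int (n r) *\<^sub>R s r + 2 *\<^sub>R of_int (- (n r div 2)) *\<^sub>R s r"
      by (simp only: scaleR_left_distrib scaleR_scaleR)
  qed
  also have "\<dots> \<in> S"
    by (intro S_add_double \<sigma>(1) int_module.span_sum int_span_of_int_scale int_module.span_base s_in_S)
  finally show ?thesis .
qed

lemma pair_sum_insert_max:
  assumes "finite J" "\<forall>r\<in>J. r < m"
  shows "pair_sum (insert m J) = pair_sum J + wedge (\<Sum>r\<in>J. s r) (s m)"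
proof -
  have m: "m \<notin> J" using assms(2) by auto
  have "(\<Sum>t\<in>J. if m < t then wedge (s m) (s t) else 0) = 0"
    using assms(2) by (intro sum.neutral) auto
  moreover have "(\<Sum>r\<in>J. if r < m then wedge (s r) (s m) else 0) = (\<Sum>r\<in>J. wedge (s r) (s m))"
    using assms(2) by (intro sum.cong) auto
  ultimately show ?thesis
    using assms(1) m by (simp add: pair_sum_def sum.distrib wedge_sum_left)
qed

lemma even_wedge_in_span:
  assumes "even k" "r \<in> {1..\<nu>}" "t \<in> {1..\<nu>}" "r < t"
  shows "of_int k *\<^sub>R wedge (s r) (s t) \<in> int_module.span rank_one_gens"
proof -
  obtain j where "k = 2 * j" using assms(1) by (elim evenE)
  then have "of_int k *\<^sub>R wedge (s r) (s t) = of_int j *\<^sub>R 2 *\<^sub>R wedge (s r) (s t)"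
    by (simp add: mult.commute)
  also have "\<dots> \<in> int_module.span rank_one_gens"
    using assms(2-4)
    by (intro int_span_of_int_scale int_module.span_base) (auto simp: rank_one_gens_def)
  finally show ?thesis .
qed

lemma even_pairs_in_span:
  assumes "\<And>r t. r \<in> {1..\<nu>} \<Longrightarrow> t \<in> {1..\<nu>} \<Longrightarrow> r < t \<Longrightarrow> even (k r t)"
  shows "(\<Sum>r\<in>{1..\<nu>}. \<Sum>t\<in>{1..\<nu>}. if r < t then of_int (k r t) *\<^sub>R wedge (s r) (s t) else 0)
    \<in> int_module.span rank_one_gens"
proof (intro int_module.span_sum)
  fix r t assume "r \<in> {1..\<nu>}" "t \<in> {1..\<nu>}"
  then show "(if r < t then of_int (k r t) *\<^sub>R wedge (s r) (s t) else 0) \<in> int_module.span rank_one_gens"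
    using even_wedge_in_span[of "k r t" r t] assms[of r t] by (simp add: int_module.span_zero)
qed

text \<open>
  \<open>n r * n t\<close> is odd exactly if both \<open>r\<close> and \<open>t\<close> lie in \<open>J\<close>, so \<open>pair_form n\<close> and \<open>pair_sum J\<close> differ by even
  multiples of wedges.
\<close>

lemma pair_form_in_span:
  assumes "J \<in> supp_class \<nu> s ` S" "J = {r \<in> {1..\<nu>}. odd (n r)}"
  shows "pair_form n \<in> int_module.span rank_one_gens"
proof -
  define k :: "nat \<Rightarrow> nat \<Rightarrow> int" where "k r t = n r * n t - of_bool (odd (n r)) * of_bool (odd (n t))" for r t
  have "pair_sum J = (\<Sum>r\<in>{1..\<nu>}. \<Sum>t\<in>{1..\<nu>}.
      if r < t then of_int (of_bool (odd (n r)) * of_bool (odd (n t))) *\<^sub>R wedge (s r) (s t) else 0)"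
    unfolding pair_sum_def assms(2)
    by (intro sum.mono_neutral_cong_left ballI sum.neutral) auto
  then have "pair_form n = pair_sum J + (\<Sum>r\<in>{1..\<nu>}. \<Sum>t\<in>{1..\<nu>}. if r < t then of_int (k r t) *\<^sub>R wedge (s r) (s t) else 0)"
    unfolding pair_form_def k_def
    by (simp only: sum.distrib[symmetric]) (intro sum.cong refl, simp add: scaleR_left_distrib[symmetric])
  moreover have "pair_sum J \<in> int_module.span rank_one_gens"
    using assms(1) by (intro int_module.span_base) (auto simp: rank_one_gens_def)
  moreover have "even (k r t)" for r t by (auto simp: k_def)
  ultimately show ?thesis by (simp only: int_module.span_add even_pairs_in_span)
qed

lemma wedge_coords:
  "wedge (\<Sum>r\<in>{1..\<nu>}. of_int (n r) *\<^sub>R s r) (\<Sum>r\<in>{1..\<nu>}. of_int (m r) *\<^sub>R s r) =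
    (\<Sum>r\<in>{1..\<nu>}. \<Sum>t\<in>{1..\<nu>}. if r < t then of_int (n r * m t - m r * n t) *\<^sub>R wedge (s r) (s t) else 0)"
proof -
  define g where "g r t = of_int (n r * m t) *\<^sub>R wedge (s r) (s t)" for r t
  have "wedge (\<Sum>r\<in>{1..\<nu>}. of_int (n r) *\<^sub>R s r) (\<Sum>r\<in>{1..\<nu>}. of_int (m r) *\<^sub>R s r) =
    (\<Sum>r\<in>{1..\<nu>}. \<Sum>t\<in>{1..\<nu>}. g r t)"
    unfolding wedge_sum_left wedge_scale_left unfolding wedge_sum_right wedge_scale_right
    by (simp add: g_def scaleR_sum_right)
  also have "\<dots> = (\<Sum>r\<in>{1..\<nu>}. \<Sum>t\<in>{1..\<nu>}. if r < t then g r t else 0) +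
      (\<Sum>r\<in>{1..\<nu>}. \<Sum>t\<in>{1..\<nu>}. if t < r then g r t else 0)"
    unfolding sum.distrib[symmetric]
  proof (intro sum.cong refl)
    show "g r t = (if r < t then g r t else 0) + (if t < r then g r t else 0)" for r t
      by (cases r t rule: linorder_cases) (auto simp: g_def)
  qed
  also have "(\<Sum>r\<in>{1..\<nu>}. \<Sum>t\<in>{1..\<nu>}. if t < r then g r t else 0) =
      (\<Sum>r\<in>{1..\<nu>}. \<Sum>t\<in>{1..\<nu>}. if r < t then g t r else 0)"
    by (rule sum.swap)
  also have "(\<Sum>r\<in>{1..\<nu>}. \<Sum>t\<in>{1..\<nu>}. if r < t then g r t else 0) + \<dots> =
    (\<Sum>r\<in>{1..\<nu>}. \<Sum>t\<in>{1..\<nu>}. if r < t then of_int (n r * m t - m r * n t) *\<^sub>R wedge (s r) (s t) else 0)"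
    unfolding sum.distrib[symmetric]
  proof (intro sum.cong refl)
    show "(if r < t then g r t else 0) + (if r < t then g t r else 0) =
      (if r < t then of_int (n r * m t - m r * n t) *\<^sub>R wedge (s r) (s t) else 0)" for r t
      using wedge_swap[of "s t" "s r"] by (simp add: g_def algebra_simps)
  qed
  finally show ?thesis .
qed


context
  assumes rank_one: "l = 1"
begin

lemma rank_one_index: "{Suc 0..l} = {Suc 0}"
  using rank_one by simp

lemma rank_one_root_coeff:
  assumes "(\<Sum>i\<in>{1..l}. of_int (k i) *\<^sub>R a i) \<in> D" "(\<Sum>i\<in>{1..l}. of_int (k i) *\<^sub>R a i) \<noteq> 0"
  shows "k 1 * k 1 = 1"
proof -
  have "B (of_int (k 1) *\<^sub>R a 1) (of_int (k 1) *\<^sub>R a 1) = 2"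
    using root_norm[OF assms] by (simp add: rank_one_index)
  moreover have "B (a 1) (a 1) = 2" using norm_simple[of 1] by (simp add: rank_one_index)
  ultimately have "of_int (k 1 * k 1) = (1::real)" by (simp add: B_simps)
  then show ?thesis by (simp only: of_int_eq_1_iff)
qed

lemma rank_one_cocycle: "cocycle x y = wedge (x 1) (y 1)"
  by (simp add: cocycle_def rank_one_index half_def)

lemma rank_one_T_map: "\<sigma> \<in> V0 \<Longrightarrow> T_map B U (a 1) \<sigma> = heis (\<lambda>_. \<sigma>) 0"
  using T_map_heis[of "a 1" "\<lambda>_. 1" \<sigma>] by (simp add: rank_one_index)

lemma T_map_simple_in_H: "\<sigma> \<in> S \<Longrightarrow> heis (\<lambda>_. \<sigma>) 0 \<in> carrier H"
  using T_map_in_H[of "a 1" \<sigma>] simple_in_D[of 1] simple_nonzero[of 1] rank_one_T_map[of \<sigma>]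
  by (simp add: rank_one_index S_radical)

lemma pair_sum_radical:
  assumes "J \<subseteq> {1..\<nu>}"
  shows "blinfun_apply (pair_sum J) f \<in> V0"
  unfolding pair_sum_def blinfun_sum_apply
proof (intro subspace_sum subspace_radical)
  fix r t assume "r \<in> J" "t \<in> J"
  then have "r \<in> {1..\<nu>}" "t \<in> {1..\<nu>}" using assms by auto
  from wedge_radical[OF this[THEN s_radical], of f]
  show "blinfun_apply (if r < t then wedge (s r) (s t) else 0) f \<in> V0"
    by (simp add: subspace_0 subspace_radical del: wedge_apply)
qed

text \<open>
  The product of the \<open>T_map B U (a 1) (s r)\<close> over \<open>r \<in> J\<close> in increasing order: each new factor wedges the
  partial sum with the new basis vector, which adds to \<open>pair_sum\<close> just the pairs ending in it.
\<close>

lemma ordered_product_in_H: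
  assumes "finite J" "J \<subseteq> {1..\<nu>}"
  shows "heis (\<lambda>_. \<Sum>r\<in>J. s r) (pair_sum J) \<in> carrier H"
  using assms
proof (induction J rule: finite_linorder_max_induct)
  case empty
  then show ?case using T_map_simple_in_H[OF S_zero] by (simp add: pair_sum_def)
next
  case (insert m J)
  have rad: "\<forall>i\<in>{1..l}. (\<Sum>r\<in>J. s r) \<in> V0" "\<forall>i\<in>{1..l}. s m \<in> V0"
    using insert.prems by (auto intro!: subspace_sum subspace_radical s_radical simp del: One_nat_def)
  have m: "m \<notin> J" using insert.hyps by auto
  have "heis (\<lambda>_. \<Sum>r\<in>J. s r) (pair_sum J) \<otimes>\<^bsub>hyp_GL U\<^esub> heis (\<lambda>_. s m) 0 =
    heis (\<lambda>_. (\<Sum>r\<in>J. s r) + s m) (pair_sum J + 0 + cocycle (\<lambda>_. \<Sum>r\<in>J. s r) (\<lambda>_. s m))"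
    by (rule heis_mult[OF rad]) (simp add: subspace_0 subspace_radical)
  also have "\<dots> = heis (\<lambda>_. \<Sum>r\<in>insert m J. s r) (pair_sum (insert m J))"
    using insert.hyps m by (simp add: rank_one_cocycle pair_sum_insert_max add.commute)
  finally show ?case
    using subgroup.m_closed[OF H_subgroup, of "heis (\<lambda>_. \<Sum>r\<in>J. s r) (pair_sum J)" "heis (\<lambda>_. s m) 0"]
      insert T_map_simple_in_H[OF s_in_S] by simp
qed

text \<open>
  Since \<open>\<Sum>r\<in>J. s r\<close> belongs to \<open>S\<close>, the tuple of the ordered product over \<open>J\<close> can be cancelled by one generator.
\<close>

lemma pair_sum_in_H:
  assumes "J \<in> supp_class \<nu> s ` S"
  shows "shear U (pair_sum J) \<in> carrier H"
proof -
  interpret G: group "hyp_GL U" by (rule group_hyp_GL)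
  have J: "J \<subseteq> {1..\<nu>}" using assms supp_class_subset by auto
  then have fin: "finite J" by (rule finite_subset) simp
  let ?\<sigma> = "\<Sum>r\<in>J. s r"
  have \<sigma>: "?\<sigma> \<in> S" by (rule supp_sum_in_S[OF assms])
  have rad: "\<forall>i\<in>{1..l}. ?\<sigma> \<in> V0" "\<forall>i\<in>{1..l}. - ?\<sigma> \<in> V0"
    using S_radical[OF \<sigma>] by (auto simp: subspace_neg subspace_radical)
  have wedge: "wedge (- ?\<sigma>) ?\<sigma> = 0" using wedge_scale_left[of "-1" ?\<sigma> ?\<sigma>] by simp
  have "heis (\<lambda>_. - ?\<sigma>) 0 \<otimes>\<^bsub>hyp_GL U\<^esub> heis (\<lambda>_. ?\<sigma>) (pair_sum J) =
      heis (\<lambda>_. - ?\<sigma> + ?\<sigma>) (0 + pair_sum J + cocycle (\<lambda>_. - ?\<sigma>) (\<lambda>_. ?\<sigma>))"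
    by (rule heis_mult[OF rad(2,1) pair_sum_radical[OF J]])
  also have "\<dots> = shear U (pair_sum J)"
    by (simp add: rank_one_cocycle wedge heis_zero)
  finally show ?thesis
    using subgroup.m_closed[OF H_subgroup T_map_simple_in_H[OF S_neg[OF \<sigma>]] ordered_product_in_H[OF fin J]]
    by simp
qed

lemma rank_one_gens_in_H:
  assumes "E \<in> rank_one_gens"
  shows "shear U E \<in> carrier H"
proof -
  have "shear U (2 *\<^sub>R wedge (s r) (s t)) \<in> carrier H" if "1 \<le> r" "r < t" "t \<le> \<nu>" for r t
  proof -
    have "1 \<in> {1..l}" by (simp add: rank_one_index)
    then show ?thesis
      using commutator_in_H[of "a 1" "a 1" "s r" "s t"] that
      by (simp add: simple_in_D simple_nonzero norm_simple s_in_S)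
  qed
  then show ?thesis using assms pair_sum_in_H by (auto simp: rank_one_gens_def)
qed

lemma rank_one_gens_radical:
  assumes "E \<in> rank_one_gens"
  shows "blinfun_apply E f \<in> V0"
  using assms unfolding rank_one_gens_def
proof
  assume "E \<in> {2 *\<^sub>R wedge (s r) (s t) | r t. 1 \<le> r \<and> r < t \<and> t \<le> \<nu>}"
  then obtain r t where rt: "1 \<le> r \<and> r < t \<and> t \<le> \<nu>" and E: "E = 2 *\<^sub>R wedge (s r) (s t)" by blast
  have "r \<in> {1..\<nu>}" "t \<in> {1..\<nu>}" using rt by auto
  then show ?thesis unfolding E
    by (simp only: scaleR_blinfun.rep_eq)
      (intro subspace_scale subspace_radical wedge_radical s_radical)
next
  assume "E \<in> {pair_sum J | J. J \<in> supp_class \<nu> s ` S}"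
  then obtain J where "J \<in> supp_class \<nu> s ` S" "E = pair_sum J" by blast
  then show ?thesis using pair_sum_radical supp_class_subset by auto
qed

text \<open>
  The invariant is that \<open>E\<close> is congruent to \<open>pair_form n\<close> modulo the integral span of the generators,
  where \<open>n\<close> lists the coordinates of \<open>x 1\<close>. A vanishing tuple has \<open>n = 0\<close>, which leaves \<open>E\<close> in that span.
\<close>

theorem center_rank_one:
  "group_center H = generate (hyp_GL U)
     ({c_elt B U s r t [^]\<^bsub>hyp_GL U\<^esub> (2::nat) | r t. 1 \<le> r \<and> r < t \<and> t \<le> \<nu>} \<union>
      {z_elt B U s J | J. J \<in> supp_class \<nu> s ` S})"
  unfolding rank_one_gens_shear generate_shear
proof (rule center_eq_shear_image[OF nullity_not_1])
  let ?L = "int_module.span rank_one_gens"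
  define \<Phi> where "\<Phi> = (\<lambda>(x :: nat \<Rightarrow> 'v) E. \<exists>n :: nat \<Rightarrow> int. x 1 = (\<Sum>r\<in>{1..\<nu>}. of_int (n r) *\<^sub>R s r) \<and> E - pair_form n \<in> ?L)"
  have pf: "blinfun_apply (pair_form n) f \<in> V0" for n f
    unfolding pair_form_def blinfun_sum_apply
  proof (intro subspace_sum subspace_radical)
    fix r t assume "r \<in> {1..\<nu>}" "t \<in> {1..\<nu>}"
    from subspace_scale[OF subspace_radical wedge_radical[OF s_radical[OF this(1)] s_radical[OF this(2)]]]
    show "blinfun_apply (if r < t then of_int (n r * n t) *\<^sub>R wedge (s r) (s t) else 0) f \<in> V0"
      by (auto simp: subspace_0 subspace_radical scaleR_blinfun.rep_eq simp del: wedge_apply)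
  qed
  have rad: "radical_valued x E" if \<Phi>: "\<Phi> x E" for x E
  proof -
    obtain n :: "nat \<Rightarrow> int" where n: "x 1 = (\<Sum>r\<in>{1..\<nu>}. of_int (n r) *\<^sub>R s r)" "E - pair_form n \<in> ?L"
      using \<Phi> by (auto simp: \<Phi>_def)
    have "x 1 \<in> V0" unfolding n(1) by (intro subspace_sum subspace_scale subspace_radical s_radical)
    moreover have "blinfun_apply E f \<in> V0" for f
    proof -
      have "blinfun_apply (E - pair_form n) f + blinfun_apply (pair_form n) f \<in> V0"
        using span_radical_valued[OF rank_one_gens_radical n(2)] pf
        by (intro subspace_add subspace_radical)
      then show ?thesis by (simp add: blinfun.bilinear_simps)
    qed
    ultimately show ?thesis by (simp add: rank_one_index radical_valued_def)
  qed
  fix h assume "h \<in> carrier H"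
  then have "\<exists>x E. \<Phi> x E \<and> h = heis x E"
  proof (rule H_heis_induct[where \<Phi> = \<Phi>])
    fix k :: "nat \<Rightarrow> int" and \<sigma>
    assume k: "(\<Sum>i\<in>{1..l}. of_int (k i) *\<^sub>R a i) \<in> D" "(\<Sum>i\<in>{1..l}. of_int (k i) *\<^sub>R a i) \<noteq> 0"
      and \<sigma>: "\<sigma> \<in> S"
    have kk: "k 1 * k 1 = 1" by (rule rank_one_root_coeff[OF k])
    have "\<sigma> \<in> \<Lambda>" using \<sigma> by (rule int_module.span_base)
    then obtain n :: "nat \<Rightarrow> int" where n: "\<sigma> = (\<Sum>r\<in>{1..\<nu>}. of_int (n r) *\<^sub>R s r)"
      "supp_class \<nu> s \<sigma> = {r \<in> {1..\<nu>}. odd (n r)}" by (rule supp_coords)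
    have "k 1 * n r * (k 1 * n t) = (k 1 * k 1) * (n r * n t)" for r t
      by (simp only: mult_ac)
    then have "k 1 * n r * (k 1 * n t) = n r * n t" for r t
      by (simp only: kk mult_1)
    then have "pair_form (\<lambda>r. k 1 * n r) = pair_form n"
      unfolding pair_form_def by (simp only:)
    then have "0 - pair_form (\<lambda>r. k 1 * n r) \<in> ?L"
      using pair_form_in_span[OF imageI[OF \<sigma>] n(2)] by (simp add: int_module.span_neg)
    moreover have "of_int (k 1) *\<^sub>R \<sigma> = (\<Sum>r\<in>{1..\<nu>}. of_int (k 1 * n r) *\<^sub>R s r)"
      by (simp add: n(1) scaleR_sum_right)
    ultimately show "\<Phi> (\<lambda>i. of_int (k i) *\<^sub>R \<sigma>) 0"
      unfolding \<Phi>_def by (intro exI[of _ "\<lambda>r. k 1 * n r"] conjI)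
  next
    show "\<Phi> (\<lambda>_. 0) 0"
      unfolding \<Phi>_def by (intro exI[of _ "\<lambda>_. 0"]) (simp add: pair_form_def int_module.span_zero cong: if_cong)
  next
    fix x E y F assume "\<Phi> x E" "\<Phi> y F"
    then obtain n m :: "nat \<Rightarrow> int" where
      n: "x 1 = (\<Sum>r\<in>{1..\<nu>}. of_int (n r) *\<^sub>R s r)" "E - pair_form n \<in> ?L" and
      m: "y 1 = (\<Sum>r\<in>{1..\<nu>}. of_int (m r) *\<^sub>R s r)" "F - pair_form m \<in> ?L"
      unfolding \<Phi>_def by blast
    \<comment> \<open>The defect of \<open>pair_form\<close> from additivity is \<open>n\<^sub>r m\<^sub>t + m\<^sub>r n\<^sub>t\<close>; the wedge has \<open>n\<^sub>r m\<^sub>t - m\<^sub>r n\<^sub>t\<close>.\<close>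
    have "pair_form n + pair_form m + wedge (x 1) (y 1) - pair_form (\<lambda>r. n r + m r) =
        (\<Sum>r\<in>{1..\<nu>}. \<Sum>t\<in>{1..\<nu>}. if r < t then of_int (- 2 * (m r * n t)) *\<^sub>R wedge (s r) (s t) else 0)"
      unfolding n(1) m(1) wedge_coords pair_form_def sum.distrib[symmetric] sum_subtractf[symmetric]
    proof (intro sum.cong refl)
      fix r t
      show "(if r < t then of_int (n r * n t) *\<^sub>R wedge (s r) (s t) else 0) +
          (if r < t then of_int (m r * m t) *\<^sub>R wedge (s r) (s t) else 0) +
          (if r < t then of_int (n r * m t - m r * n t) *\<^sub>R wedge (s r) (s t) else 0) -
          (if r < t then of_int ((n r + m r) * (n t + m t)) *\<^sub>R wedge (s r) (s t) else 0) =
          (if r < t then of_int (- 2 * (m r * n t)) *\<^sub>R wedge (s r) (s t) else 0)"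
      proof (cases "r < t")
        case True
        have eq: "n r * n t + m r * m t + (n r * m t - m r * n t) - (n r + m r) * (n t + m t) =
            - 2 * (m r * n t)"
          by (simp add: algebra_simps)
        from True show ?thesis
          by (simp only: if_True scaleR_left_distrib[symmetric] scaleR_left_diff_distrib[symmetric]
              of_int_add[symmetric] of_int_diff[symmetric] eq)
      qed simp
    qed
    also have "\<dots> \<in> ?L" by (rule even_pairs_in_span) simp
    finally have "(E - pair_form n) + (F - pair_form m) +
        (pair_form n + pair_form m + wedge (x 1) (y 1) - pair_form (\<lambda>r. n r + m r)) \<in> ?L"
      using n(2) m(2) by (intro int_module.span_add)
    then have "E + F + cocycle x y - pair_form (\<lambda>r. n r + m r) \<in> ?L"
      by (simp add: rank_one_cocycle algebra_simps)
    moreover have "x 1 + y 1 = (\<Sum>r\<in>{1..\<nu>}. of_int (n r + m r) *\<^sub>R s r)"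
      unfolding n(1) m(1) by (simp add: scaleR_left_distrib sum.distrib)
    ultimately show "\<Phi> (\<lambda>i. x i + y i) (E + F + cocycle x y)"
      unfolding \<Phi>_def by (intro exI[of _ "\<lambda>r. n r + m r"] conjI)
  next
    show "radical_valued x E" if "\<Phi> x E" for x E by (rule rad[OF that])
  qed
  then obtain x E where \<Phi>: "\<Phi> x E" and h: "h = heis x E" by blast
  have "E \<in> ?L" if "\<forall>i\<in>{1..l}. x i = 0"
  proof -
    obtain n :: "nat \<Rightarrow> int" where n: "x 1 = (\<Sum>r\<in>{1..\<nu>}. of_int (n r) *\<^sub>R s r)" "E - pair_form n \<in> ?L"
      using \<Phi> by (auto simp: \<Phi>_def)
    have "x 1 = 0" using that by (simp add: rank_one_index)
    then have "n r = 0" if "r \<in> {1..\<nu>}" for r using s_coeff_zero[of n r] n(1) that by simp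
    then have "pair_form n = 0" unfolding pair_form_def by (intro sum.neutral ballI) simp
    then show ?thesis using n(2) by simp
  qed
  then show "\<exists>x E. radical_valued x E \<and> ((\<forall>i\<in>{1..l}. x i = 0) \<longrightarrow> E \<in> ?L) \<and> h = heis x E"
    using rad[OF \<Phi>] h by blast
next
  fix E assume E: "E \<in> int_module.span rank_one_gens"
  show "shear U E \<in> carrier H" by (rule span_in_H[OF rank_one_gens_in_H E])
  show "blinfun_apply E f \<in> V0" for f by (rule span_radical_valued[OF rank_one_gens_radical E])
qed

text \<open>
  In a lattice every two-element set is a support, and the corresponding \<open>z\<close> is a single \<open>c\<close>.
\<close>

lemma center_rank_one_lattice:
  assumes "lattice_in V0 S"
  shows "group_center H = generate (hyp_GL U) {c_elt B U s r t | r t. 1 \<le> r \<and> r < t \<and> t \<le> \<nu>}"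
proof (rule center_eq_generate_c)
  fix r t assume rt: "1 \<le> r" "r < t" "t \<le> \<nu>"
  then have S: "s r \<in> S" "s t \<in> S" by (auto intro: s_in_S)
  then have "s r + s t \<in> S" using assms by (auto simp: lattice_in_def)
  then have "heis (\<lambda>_. - (s r + s t)) 0 \<in> carrier H" by (intro T_map_simple_in_H S_neg)
  moreover have "heis (\<lambda>_. \<Sum>q\<in>{r, t}. s q) (pair_sum {r, t}) \<in> carrier H"
    using rt by (intro ordered_product_in_H) auto
  moreover have "(\<Sum>q\<in>{r, t}. s q) = s r + s t" "pair_sum {r, t} = wedge (s r) (s t)"
    using rt by (simp_all add: pair_sum_def)
  moreover have "heis (\<lambda>_. - (s r + s t)) 0 \<otimes>\<^bsub>hyp_GL U\<^esub> heis (\<lambda>_. s r + s t) (wedge (s r) (s t)) =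
      heis (\<lambda>_. - (s r + s t) + (s r + s t)) (0 + wedge (s r) (s t) + cocycle (\<lambda>_. - (s r + s t)) (\<lambda>_. s r + s t))"
    using S by (intro heis_mult ballI wedge_radical)
      (auto simp: subspace_neg subspace_add subspace_diff subspace_radical S_radical)
  moreover have "\<dots> = shear U (wedge (s r) (s t))"
    using wedge_scale_left[of "-1" "s r + s t" "s r + s t"] by (simp add: rank_one_cocycle heis_zero)
  ultimately show "shear U (wedge (s r) (s t)) \<in> carrier H"
    using subgroup.m_closed[OF H_subgroup] by metis
qed

end

end

theorem corollary2p25:
  fixes B :: "'v::euclidean_space \<Rightarrow> 'v \<Rightarrow> real"
    and R U S :: "'v set"
    and X :: simply_laced_type
    and \<alpha> s :: "nat \<Rightarrow> 'v"
    and \<nu> :: nat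
  assumes "simply_laced_ears B R X U S"
    and "fundamental_system (finite_part B U R) (type_rank X) \<alpha>"
    and "\<forall>i \<in> {1..type_rank X}. B (\<alpha> i) (\<alpha> i) = 2"
    and "\<nu> = dim (form_radical B)"
    and "\<nu> \<noteq> 1"
    and "int_basis S \<nu> s"
  shows
    "(X = A_type 1 \<longrightarrow>
        group_center (heisenberg_group B U R) =
          generate (hyp_GL U)
            ({c_elt B U s r t [^]\<^bsub>hyp_GL U\<^esub> (2::nat) | r t. 1 \<le> r \<and> r < t \<and> t \<le> \<nu>} \<union>
             {z_elt B U s J | J. J \<in> supp_class \<nu> s ` S}) \<and>
        (lattice_in (form_radical B) S \<longrightarrow>
          group_center (heisenberg_group B U R) =
            generate (hyp_GL U) {c_elt B U s r t | r t. 1 \<le> r \<and> r < t \<and> t \<le> \<nu>})) \<and>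
     ((\<exists>l\<ge>2. X = A_type l) \<or> (\<exists>l\<ge>4. X = D_type l) \<or> X \<in> {E_type 6, E_type 7, E_type 8} \<longrightarrow>
        group_center (heisenberg_group B U R) =
          generate (hyp_GL U) {c_elt B U s r t | r t. 1 \<le> r \<and> r < t \<and> t \<le> \<nu>})"
proof -
  interpret based_setup B U R "type_rank X" \<alpha> S \<nu> s
    using assms by unfold_locales (auto simp: simply_laced_ears_def ears_def)
  have type: "has_type B D X" using assms(1) by (simp add: simply_laced_ears_def)
  have "group_center H = generate (hyp_GL U) {c_elt B U s r t | r t. 1 \<le> r \<and> r < t \<and> t \<le> \<nu>}"
    if X: "(\<exists>l\<ge>2. X = A_type l) \<or> (\<exists>l\<ge>4. X = D_type l) \<or> X \<in> {E_type 6, E_type 7, E_type 8}"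
  proof -
    obtain b where b: "fundamental_system D (type_rank X) b"
      and cartan: "\<forall>i \<in> {1..type_rank X}. \<forall>j \<in> {1..type_rank X}.
         B (b i) (coroot B (b j)) = of_int (cartan_matrix X i j)"
      using type unfolding has_type_def by blast
    \<comment> \<open>In the Bourbaki labelling the node 1 is joined to 3 in type \<open>E\<close> and to 2 otherwise.\<close>
    obtain i j where ij: "i \<in> {1..type_rank X}" "j \<in> {1..type_rank X}" "cartan_matrix X i j = -1"
    proof -
      have "cartan_matrix X 1 2 = -1 \<or> cartan_matrix X 1 3 = -1" "2 \<le> type_rank X"
        "cartan_matrix X 1 2 = -1 \<or> 3 \<le> type_rank X"
        using X by (auto simp: cartan_matrix_def)
      then show ?thesis
        using that[of 1 2] that[of 1 3] by (cases "cartan_matrix X 1 2 = -1") auto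
    qed
    have bD: "b i \<in> D" "b j \<in> D" using b ij by (auto simp: fundamental_system_def)
    have pair: "B (b i) (coroot B (b j)) = - 1" using cartan ij by simp
    then have nz: "b i \<noteq> 0" "b j \<noteq> 0" by (auto simp: B_simps coroot_def)
    then have "B (b i) (b j) = - 1" using pair root_norm[OF bD(2)] by (simp add: coroot_def)
    with bD nz show ?thesis by (intro center_higher_rank)
  qed
  moreover have "type_rank X = 1" if "X = A_type 1" using that by simp
  ultimately show ?thesis using center_rank_one center_rank_one_lattice by blast
qed

end
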